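(* Let $R$ be a commutative ring with $1$, $A$ a commutative $R$-algebra and $L$ a finitely generated projective $A$-module. Then Lie-Rinehart algebra structures on $(A,L)$ and Maurer-Cartan algebra structures on $\mathrm{Alt}_A(L,A)$ are equivalent notions: assigning to a Lie-Rinehart structure on $(A,L)$ its Cartan-Chevalley-Eilenberg operator $d$ on $\mathrm{Alt}_A(L,A)$ defines a bijection from the set of Lie-Rinehart structures on $(A,L)$ (compatible with the given $A$-module structure on $L$) onto the set of $R$-derivations $d$ of the graded algebra $\mathrm{Alt}_A(L,A)$, raising the number of variables by one, with $dd=0$.
   Context: A Lie-Rinehart structure on $(A,L)$ consists of an $R$-Lie bracket on $L$ and a morphism of $R$-Lie algebras $L\to\mathrm{Der}_R(A)$, $x\mapsto(a\mapsto x(a))$, with $(ax)(b)=a(x(b))$ and $[x,ay]=x(a)y+a[x,y]$ for $a,b\in A$, $x,y\in L$. $\mathrm{Alt}_A(L,A)$ is the graded $A$-algebra of $A$-multilinear alternating $A$-valued forms on $L$; a form $f$ of $m$ variables has degree $|f|=-m$. The product follows the Eilenberg-Koszul convention: $fg=(-1)^{|f||g|}f\wedge g$, where $\wedge$ is the usual shuffle product of alternating forms. A derivation satisfies $d(fg)=(df)g+(-1)^{|f|}f\,dg$. A Maurer-Cartan algebra structure on $\mathrm{Alt}_A(L,A)$ is an $R$-derivation $d$ of degree $-1$ (raising the number of variables by one) with $dd=0$. The Cartan-Chevalley-Eilenberg operator: for a form $f$ of $m-1$ variables, $$(-1)^{|f|+1}(df)(\alpha_1,\dots,\alpha_m)=\sum_{i=1}^m(-1)^{i-1}\alpha_i(f(\alpha_1,\dots\widehat{\alpha_i}\dots,\alpha_m))+\sum_{1\le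 j<k\le m}(-1)^{j+k}f([\alpha_j,\alpha_k],\alpha_1,\dots\widehat{\alpha_j}\dots\widehat{\alpha_k}\dots,\alpha_m).$$ *)

theory Defs
  imports Main "HOL-Library.FuncSet" "HOL-Library.Poly_Mapping" "HOL-Combinatorics.Permutations"
begin

text \<open>
  Commutative rings with 1 are types of sort \<open>{comm_ring, comm_monoid_mult}\<close>. This is
  \<open>comm_ring_1\<close> without the axiom \<open>0 \<noteq> 1\<close>, so the zero ring is included. Since
  \<open>Modules.module\<close> is restricted to \<open>comm_ring_1\<close>, its axioms are repeated here for the
  more general sort.
\<close>

locale unital_module =
  fixes scale :: "'a::{comm_ring, comm_monoid_mult} \<Rightarrow> 'l::ab_group_add \<Rightarrow> 'l"
  assumes scale_add_right: "scale a (x + y) = scale a x + scale a y"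
    and scale_add_left: "scale (a + b) x = scale a x + scale b x"
    and scale_scale: "scale a (scale b x) = scale (a * b) x"
    and scale_one: "scale 1 x = x"

text \<open>A commutative \<open>R\<close>-algebra structure on \<open>A\<close> is given by its structure map \<open>R \<rightarrow> A\<close>.\<close>

locale comm_algebra =
  fixes \<eta> :: "'r::{comm_ring, comm_monoid_mult} \<Rightarrow> 'a::{comm_ring, comm_monoid_mult}"
  assumes unit_add: "\<eta> (r + s) = \<eta> r + \<eta> s"
    and unit_mult: "\<eta> (r * s) = \<eta> r * \<eta> s"
    and unit_one: "\<eta> 1 = 1"

definition linear_map ::
  "('a \<Rightarrow> 'l::ab_group_add \<Rightarrow> 'l) \<Rightarrow> ('a \<Rightarrow> 'm::ab_group_add \<Rightarrow> 'm) \<Rightarrow> ('l \<Rightarrow> 'm) \<Rightarrow> bool" where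
  "linear_map s t h \<longleftrightarrow>
     (\<forall>x y. h (x + y) = h x + h y) \<and> (\<forall>a x. h (s a x) = t a (h x))"

definition finitely_generated ::
  "('a::{comm_ring, comm_monoid_mult} \<Rightarrow> 'l::ab_group_add \<Rightarrow> 'l) \<Rightarrow> bool" where
  "finitely_generated scale \<longleftrightarrow>
     (\<exists>S. finite S \<and> (\<forall>x. \<exists>c. x = (\<Sum>s\<in>S. scale (c s) s)))"

text \<open>
  A module \<open>L\<close> is projective if it is a direct summand of a free module. The index type of the
  basis can be taken to be (the type of) \<open>L\<close> itself: \<open>L\<close> is projective iff the canonical
  surjection from the free module on the elements of \<open>L\<close> onto \<open>L\<close> splits.
\<close>

definition free_scale ::
  "'a::{comm_ring, comm_monoid_mult} \<Rightarrow> ('i \<Rightarrow>\<^sub>0 'a) \<Rightarrow> ('i \<Rightarrow>\<^sub>0 'a)" where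
  "free_scale a v = Poly_Mapping.map (\<lambda>b. a * b) v"

definition projective ::
  "('a::{comm_ring, comm_monoid_mult} \<Rightarrow> 'l::ab_group_add \<Rightarrow> 'l) \<Rightarrow> bool" where
  "projective scale \<longleftrightarrow>
     (\<exists>(\<iota> :: 'l \<Rightarrow> ('l \<Rightarrow>\<^sub>0 'a)) \<pi>.
        linear_map scale free_scale \<iota> \<and> linear_map free_scale scale \<pi> \<and> (\<forall>x. \<pi> (\<iota> x) = x))"


subsection \<open>Lie-Rinehart structures\<close>

definition is_derivation ::
  "('r \<Rightarrow> 'a::{comm_ring, comm_monoid_mult}) \<Rightarrow> ('a \<Rightarrow> 'a) \<Rightarrow> bool" where
  "is_derivation \<eta> \<delta> \<longleftrightarrow>
     (\<forall>a b. \<delta> (a + b) = \<delta> a + \<delta> b) \<and>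
     (\<forall>r a. \<delta> (\<eta> r * a) = \<eta> r * \<delta> a) \<and>
     (\<forall>a b. \<delta> (a * b) = \<delta> a * b + a * \<delta> b)"

definition is_lie_bracket ::
  "('r \<Rightarrow> 'a) \<Rightarrow> ('a::{comm_ring, comm_monoid_mult} \<Rightarrow> 'l::ab_group_add \<Rightarrow> 'l) \<Rightarrow>
     ('l \<Rightarrow> 'l \<Rightarrow> 'l) \<Rightarrow> bool" where
  "is_lie_bracket \<eta> scale br \<longleftrightarrow>
     (\<forall>x y z. br (x + y) z = br x z + br y z) \<and>
     (\<forall>x y z. br x (y + z) = br x y + br x z) \<and>
     (\<forall>r x y. br (scale (\<eta> r) x) y = scale (\<eta> r) (br x y)) \<and>
     (\<forall>r x y. br x (scale (\<eta> r) y) = scale (\<eta> r) (br x y)) \<and>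
     (\<forall>x. br x x = 0) \<and>
     (\<forall>x y z. br x (br y z) + br y (br z x) + br z (br x y) = 0)"

definition is_lie_morphism_to_Der ::
  "('r \<Rightarrow> 'a) \<Rightarrow> ('a::{comm_ring, comm_monoid_mult} \<Rightarrow> 'l::ab_group_add \<Rightarrow> 'l) \<Rightarrow>
     ('l \<Rightarrow> 'l \<Rightarrow> 'l) \<Rightarrow> ('l \<Rightarrow> 'a \<Rightarrow> 'a) \<Rightarrow> bool" where
  "is_lie_morphism_to_Der \<eta> scale br anchor \<longleftrightarrow>
     (\<forall>x. is_derivation \<eta> (anchor x)) \<and>
     (\<forall>x y a. anchor (x + y) a = anchor x a + anchor y a) \<and>
     (\<forall>r x a. anchor (scale (\<eta> r) x) a = \<eta> r * anchor x a) \<and>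
     (\<forall>x y a. anchor (br x y) a = anchor x (anchor y a) - anchor y (anchor x a))"

definition lie_rinehart_structures ::
  "('r \<Rightarrow> 'a) \<Rightarrow> ('a::{comm_ring, comm_monoid_mult} \<Rightarrow> 'l::ab_group_add \<Rightarrow> 'l) \<Rightarrow>
     (('l \<Rightarrow> 'l \<Rightarrow> 'l) \<times> ('l \<Rightarrow> 'a \<Rightarrow> 'a)) set" where
  "lie_rinehart_structures \<eta> scale =
     {(br, anchor).
        is_lie_bracket \<eta> scale br \<and>
        is_lie_morphism_to_Der \<eta> scale br anchor \<and>
        (\<forall>a x b. anchor (scale a x) b = a * anchor x b) \<and>
        (\<forall>x a y. br x (scale a y) = scale (anchor x a) y + scale a (br x y))}"


subsection \<open>The graded algebra of alternating forms\<close>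

text \<open>
  A form of \<open>m\<close> variables is a function on lists that vanishes on all lists of length other than
  \<open>m\<close>. The direct sum of these spaces of forms is then a space of functions on lists of arbitrary
  length, and the homogeneous components of an element are its restrictions to the lists of a
  fixed length.
\<close>

definition alt_forms ::
  "('a::{comm_ring, comm_monoid_mult} \<Rightarrow> 'l::ab_group_add \<Rightarrow> 'l) \<Rightarrow> nat \<Rightarrow> ('l list \<Rightarrow> 'a) set" where
  "alt_forms scale m =
     {f. (\<forall>xs. length xs \<noteq> m \<longrightarrow> f xs = 0) \<and>
         (\<forall>xs i x y. length xs = m \<longrightarrow> i < m \<longrightarrow> f (xs[i := x + y]) = f (xs[i := x]) + f (xs[i := y])) \<and>
         (\<forall>xs i a x. length xs = m \<longrightarrow> i < m \<longrightarrow> f (xs[i := scale a x]) = a * f (xs[i := x])) \<and>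
         (\<forall>xs i j. length xs = m \<longrightarrow> i < j \<longrightarrow> j < m \<longrightarrow> xs ! i = xs ! j \<longrightarrow> f xs = 0)}"

definition component :: "nat \<Rightarrow> ('l list \<Rightarrow> 'a::zero) \<Rightarrow> 'l list \<Rightarrow> 'a" where
  "component m f = (\<lambda>xs. if length xs = m then f xs else 0)"

definition Alt ::
  "('a::{comm_ring, comm_monoid_mult} \<Rightarrow> 'l::ab_group_add \<Rightarrow> 'l) \<Rightarrow> ('l list \<Rightarrow> 'a) set" where
  "Alt scale =
     {f. (\<forall>m. component m f \<in> alt_forms scale m) \<and> finite {m. component m f \<noteq> (\<lambda>xs. 0)}}"

definition shuffle_perms :: "nat \<Rightarrow> nat \<Rightarrow> (nat \<Rightarrow> nat) set" where
  "shuffle_perms p q =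
     {\<sigma>. \<sigma> permutes {..<p + q} \<and> strict_mono_on {..<p} \<sigma> \<and> strict_mono_on {p..<p + q} \<sigma>}"

definition wedge ::
  "nat \<Rightarrow> nat \<Rightarrow> ('l list \<Rightarrow> 'a::{comm_ring, comm_monoid_mult}) \<Rightarrow> ('l list \<Rightarrow> 'a) \<Rightarrow> 'l list \<Rightarrow> 'a" where
  "wedge p q f g xs =
     (if length xs = p + q then
        (\<Sum>\<sigma>\<in>shuffle_perms p q.
           (if evenperm \<sigma> then 1 else - 1) *
           (f (map (\<lambda>i. xs ! \<sigma> i) [0..<p]) * g (map (\<lambda>i. xs ! \<sigma> i) [p..<p + q])))
      else 0)"

text \<open>
  The product \<open>f g = (-1)\<^bsup>|f||g|\<^esup> f \<and> g\<close>, extended bilinearly: on lists of length \<open>n\<close>, the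
  summand for \<open>p\<close> only involves the components of \<open>f\<close> and \<open>g\<close> with \<open>p\<close> and \<open>n - p\<close> variables.
\<close>

definition alt_mult ::
  "('l list \<Rightarrow> 'a::{comm_ring, comm_monoid_mult}) \<Rightarrow> ('l list \<Rightarrow> 'a) \<Rightarrow> 'l list \<Rightarrow> 'a" where
  "alt_mult f g xs =
     (\<Sum>p\<le>length xs. (- 1) ^ (p * (length xs - p)) * wedge p (length xs - p) f g xs)"

text \<open>
  Operators on \<open>Alt\<close> are represented by functions that are \<open>undefined\<close> outside \<open>Alt\<close>, so that
  equality of operators is equality on \<open>Alt\<close>. A form of \<open>p\<close> variables has degree \<open>-p\<close>; this
  degree enters the signs only through its parity.
\<close>

definition maurer_cartan_structures ::
  "('r \<Rightarrow> 'a) \<Rightarrow> ('a::{comm_ring, comm_monoid_mult} \<Rightarrow> 'l::ab_group_add \<Rightarrow> 'l) \<Rightarrow>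
     (('l list \<Rightarrow> 'a) \<Rightarrow> ('l list \<Rightarrow> 'a)) set" where
  "maurer_cartan_structures \<eta> scale =
     {d. d \<in> Alt scale \<rightarrow>\<^sub>E Alt scale \<and>
         (\<forall>f\<in>Alt scale. \<forall>g\<in>Alt scale. d (\<lambda>xs. f xs + g xs) = (\<lambda>xs. d f xs + d g xs)) \<and>
         (\<forall>r. \<forall>f\<in>Alt scale. d (\<lambda>xs. \<eta> r * f xs) = (\<lambda>xs. \<eta> r * d f xs)) \<and>
         (\<forall>m. \<forall>f\<in>alt_forms scale m. d f \<in> alt_forms scale (Suc m)) \<and>
         (\<forall>p q. \<forall>f\<in>alt_forms scale p. \<forall>g\<in>alt_forms scale q.
            d (alt_mult f g) = (\<lambda>xs. alt_mult (d f) g xs + (- 1) ^ p * alt_mult f (d g) xs)) \<and>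
         (\<forall>f\<in>Alt scale. d (d f) = (\<lambda>xs. 0))}"


subsection \<open>The Cartan-Chevalley-Eilenberg operator\<close>

text \<open>
  Positions in lists are counted from 0, which turns the sign \<open>(-1)\<^bsup>i-1\<^esup>\<close> of the usual formula
  into \<open>(-1)\<^bsup>i\<^esup>\<close> and leaves \<open>(-1)\<^bsup>j+k\<^esup>\<close> unchanged. On a list of length \<open>m\<close> the component of \<open>f\<close>
  of \<open>m - 1\<close> variables, of degree \<open>|f| = 1 - m\<close>, contributes; hence the sign
  \<open>(-1)\<^bsup>|f|+1\<^esup> = (-1)\<^bsup>m\<^esup>\<close>.
\<close>

definition cce ::
  "('a::{comm_ring, comm_monoid_mult} \<Rightarrow> 'l::ab_group_add \<Rightarrow> 'l) \<Rightarrow>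
     ('l \<Rightarrow> 'l \<Rightarrow> 'l) \<Rightarrow> ('l \<Rightarrow> 'a \<Rightarrow> 'a) \<Rightarrow> ('l list \<Rightarrow> 'a) \<Rightarrow> ('l list \<Rightarrow> 'a)" where
  "cce scale br anchor =
     (\<lambda>f\<in>Alt scale. \<lambda>xs.
        (- 1) ^ length xs *
        ((\<Sum>i<length xs. (- 1) ^ i * anchor (xs ! i) (f (nths xs (- {i})))) +
         (\<Sum>k<length xs. \<Sum>j<k. (- 1) ^ (j + k) * f (br (xs ! j) (xs ! k) # nths xs (- {j, k})))))"

end

theory Submission
  imports Defs "HOL-Library.Function_Algebras"
begin

text \<open>
  All operators on forms are recursive in the list of arguments, through the contraction
  \<open>ins x f = f (x, -)\<close>: the wedge product satisfies
  \<open>ins x (f \<and> g) = ins x f \<and> g + (-1)\<^sup>p f \<and> ins x g\<close>, the Lie derivative satisfies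
  \<open>ins y (L\<^sub>x f) = L\<^sub>x (ins y f) - ins [x, y] f\<close>, and Cartan's formula
  \<open>ins x (D f) = L\<^sub>x f - D (ins x f)\<close> describes the unsigned Cartan-Chevalley-Eilenberg operator
  \<open>D\<close>. With these rules every identity of Cartan calculus is a list induction; that \<open>D\<close> is an
  antiderivation preserving alternating forms needs neither the Jacobi identity nor the anchor to be
  a Lie morphism.

  For the converse, \<open>(P + \<phi> e)\<^sup>* f = P\<^sup>* f + \<phi> \<and> P\<^sup>* (ins e f)\<close> for a linear form
  \<open>\<phi>\<close> and a vector \<open>e\<close>. Writing the identity of \<open>L\<close> as \<open>\<Sum>\<^sub>t \<phi>\<^sub>t e\<^sub>t\<close> with a finite
  dual basis shows, without dividing by factorials, that the forms are generated in degrees 0 and 1.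
  So a derivation \<open>d\<close> is determined by \<open>x(a) = - (d a) (x)\<close> and
  \<open>\<phi> [x, y] = x (\<phi> y) - y (\<phi> x) - (d \<phi>) (x, y)\<close>; the right-hand side is evaluation of
  \<open>\<phi>\<close> at a unique element of \<open>L\<close>. Finally \<open>dd = 0\<close> in degree 0 says that the anchor is a
  Lie morphism, and in degree 1 it is the Jacobi identity.
\<close>

subsection \<open>Shuffle products of functions on lists\<close>

lemma minus_one_power_mult:
  fixes a :: "'a::{comm_ring, comm_monoid_mult}"
  shows "(- 1) ^ n * a = (if even n then a else - a)"
proof (induction n)
  case (Suc n)
  have "(- 1 :: 'a) ^ Suc n * a = - (1 * ((- 1) ^ n * a))"
    by (simp only: power_Suc mult.assoc minus_mult_left [symmetric])
  then show ?case using Suc by simp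
qed simp

definition ins :: "'l \<Rightarrow> ('l list \<Rightarrow> 'a) \<Rightarrow> 'l list \<Rightarrow> 'a" where
  "ins x f = (\<lambda>xs. f (x # xs))"

text \<open>The grading involution. Writing the Koszul sign as an operator on functions, instead of
  a power depending on a degree, lets the product and Leibniz rules hold for inhomogeneous functions
  as well.\<close>

definition grade_sign :: "('l list \<Rightarrow> 'a::{comm_ring, comm_monoid_mult}) \<Rightarrow> 'l list \<Rightarrow> 'a" where
  "grade_sign f = (\<lambda>xs. (- 1) ^ length xs * f xs)"

definition smul :: "'a::{comm_ring, comm_monoid_mult} \<Rightarrow> ('l list \<Rightarrow> 'a) \<Rightarrow> 'l list \<Rightarrow> 'a" where
  "smul a f = (\<lambda>xs. a * f xs)"

lemma ins_apply: "ins x f xs = f (x # xs)"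
  by (simp add: ins_def)

lemma smul_apply: "smul a f xs = a * f xs"
  by (simp add: smul_def)

lemma grade_sign_apply: "grade_sign f xs = (if even (length xs) then f xs else - f xs)"
  by (simp add: grade_sign_def minus_one_power_mult)

lemma ins_simps [simp]:
  "ins x (f + g) = ins x f + ins x g"
  "ins x (f - g) = ins x f - ins x g"
  "ins x (- f) = - ins x f"
  "ins x 0 = 0"
  "ins x (smul a f) = smul a (ins x f)"
  "ins x (grade_sign f) = - grade_sign (ins x f)"
  by (auto simp: ins_def smul_def fun_eq_iff grade_sign_apply zero_fun_def)

lemma grade_sign_simps [simp]:
  "grade_sign (f + g) = grade_sign f + grade_sign g"
  "grade_sign (f - g) = grade_sign f - grade_sign g"
  "grade_sign (- f) = - grade_sign f"
  "grade_sign (0 :: 'l list \<Rightarrow> 'a::{comm_ring, comm_monoid_mult}) = 0"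
  "grade_sign (smul a f) = smul a (grade_sign f)"
  "grade_sign (grade_sign f) = f"
  by (auto simp: smul_def fun_eq_iff grade_sign_apply)

lemma smul_simps [simp]:
  "smul a (f + g) = smul a f + smul a g"
  "smul a (f - g) = smul a f - smul a g"
  "smul a (- f) = - smul a f"
  "smul a 0 = 0"
  "smul 0 f = 0"
  "smul 1 f = f"
  "smul a (smul b f) = smul (a * b) f"
  "smul (- a) f = - smul a f"
  "smul (a + b) f = smul a f + smul b f"
  by (auto simp: smul_def fun_eq_iff algebra_simps)

lemma smul_minus_one_power: "smul ((- 1) ^ n) f = (if even n then f else - f)"
  by (simp add: fun_eq_iff smul_apply minus_one_power_mult)

text \<open>The antiderivation rule for contraction, taken as the definition of the wedge product.
  It makes sense for arbitrary functions, so bilinearity and all product rules become inductions on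
  the argument list; \<open>shuf_eq_wedge\<close> identifies it with the sum over shuffle
  permutations.\<close>

primrec shuf ::
  "('l list \<Rightarrow> 'a::{comm_ring, comm_monoid_mult}) \<Rightarrow> ('l list \<Rightarrow> 'a) \<Rightarrow> 'l list \<Rightarrow> 'a" where
  "shuf f g [] = f [] * g []"
| "shuf f g (x # xs) = shuf (ins x f) g xs + shuf (grade_sign f) (ins x g) xs"

lemma ins_shuf [simp]: "ins x (shuf f g) = shuf (ins x f) g + shuf (grade_sign f) (ins x g)"
  by (simp add: ins_def fun_eq_iff)

lemma shuf_add_left: "shuf (f + f') g xs = shuf f g xs + shuf f' g xs"
  by (induction xs arbitrary: f f' g) (simp_all add: algebra_simps)

lemma shuf_add_right: "shuf f (g + g') xs = shuf f g xs + shuf f g' xs"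
  by (induction xs arbitrary: f g g') (simp_all add: algebra_simps)

lemma shuf_smul_left: "shuf (smul a f) g xs = a * shuf f g xs"
  by (induction xs arbitrary: f g) (simp_all add: algebra_simps smul_apply)

lemma shuf_smul_right: "shuf f (smul a g) xs = a * shuf f g xs"
  by (induction xs arbitrary: f g) (simp_all add: algebra_simps smul_apply)

lemma shuf_zero_left: "shuf 0 g xs = 0"
  by (induction xs arbitrary: g) (simp_all)

lemma shuf_zero_right: "shuf f 0 xs = 0"
  by (induction xs arbitrary: f) (simp_all)

lemma shuf_minus_left: "shuf (- f) g xs = - shuf f g xs"
  by (induction xs arbitrary: f g) (simp_all)

lemma shuf_minus_right: "shuf f (- g) xs = - shuf f g xs"
  by (induction xs arbitrary: f g) (simp_all)

lemma shuf_simps [simp]: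
  "shuf (f + f') g = shuf f g + shuf f' g"
  "shuf f (g + g') = shuf f g + shuf f g'"
  "shuf (- f) g = - shuf f g"
  "shuf f (- g) = - shuf f g"
  "shuf 0 g = 0"
  "shuf f 0 = 0"
  "shuf (smul a f) g = smul a (shuf f g)"
  "shuf f (smul a g) = smul a (shuf f g)"
  by (simp_all add: fun_eq_iff shuf_add_left shuf_add_right shuf_zero_left shuf_zero_right
        shuf_minus_left shuf_minus_right shuf_smul_left shuf_smul_right smul_apply)

lemma shuf_diff [simp]:
  "shuf (f - f') g = shuf f g - shuf f' g"
  "shuf f (g - g') = shuf f g - shuf f g'"
  using shuf_simps(1) [of f "- f'" g] shuf_simps(2) [of f g "- g'"]
  by (simp_all del: add_uminus_conv_diff add: diff_conv_add_uminus)

lemma grade_sign_shuf [simp]: "grade_sign (shuf f g) = shuf (grade_sign f) (grade_sign g)"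
proof
  fix xs show "grade_sign (shuf f g) xs = shuf (grade_sign f) (grade_sign g) xs"
  proof (induction xs arbitrary: f g)
    case (Cons x xs)
    have "grade_sign (shuf f g) (x # xs) =
       - grade_sign (shuf (ins x f) g) xs - grade_sign (shuf (grade_sign f) (ins x g)) xs"
      by (simp add: grade_sign_apply)
    then show ?case by (simp add: Cons)
  qed (simp add: grade_sign_apply)
qed

definition const_form :: "'a::zero \<Rightarrow> 'l list \<Rightarrow> 'a" where
  "const_form a = (\<lambda>xs. if xs = [] then a else 0)"

lemma ins_const_form [simp]: "ins x (const_form a) = 0"
  by (simp add: ins_def const_form_def fun_eq_iff)

lemma grade_sign_const_form [simp]: "grade_sign (const_form a) = const_form a"
  by (auto simp: const_form_def fun_eq_iff grade_sign_apply)

lemma const_form_Nil [simp]: "const_form a [] = a"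
  by (simp add: const_form_def)

lemma const_form_Cons [simp]: "const_form a (x # xs) = 0"
  by (simp add: const_form_def)

lemma shuf_const_form [simp]: "shuf (const_form a) g = smul a g"
proof
  fix xs show "shuf (const_form a) g xs = smul a g xs"
    by (induction xs arbitrary: g) (simp_all add: smul_apply ins_apply)
qed

section \<open>Alternating functions on lists\<close>

context unital_module
begin

text \<open>Only adjacent repetitions are tested and no number of variables is fixed, which makes
  the notion visibly stable under contraction and applicable to inhomogeneous functions.
  \<open>alt_forms_iff\<close> relates it to forms of \<open>m\<close> variables.\<close>

definition alternating :: "('l list \<Rightarrow> 'a) \<Rightarrow> bool" where
  "alternating f \<longleftrightarrow>
     (\<forall>us x y vs. f (us @ (x + y) # vs) = f (us @ x # vs) + f (us @ y # vs)) \<and>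
     (\<forall>us a x vs. f (us @ scale a x # vs) = a * f (us @ x # vs)) \<and>
     (\<forall>us x vs. f (us @ x # x # vs) = 0)"

lemma alternating_ins: "alternating f \<Longrightarrow> alternating (ins x f)"
  unfolding alternating_def ins_def by (metis append_Cons)

lemma alternating_head:
  assumes "alternating f"
  shows "ins (x + y) f = ins x f + ins y f"
    and "ins (scale a x) f = smul a (ins x f)"
    and "ins x (ins x f) = 0"
proof -
  have "f ([] @ (x + y) # vs) = f ([] @ x # vs) + f ([] @ y # vs)"
    "f ([] @ scale a x # vs) = a * f ([] @ x # vs)" "f ([] @ x # x # vs) = 0" for vs
    using assms unfolding alternating_def by blast+
  then show "ins (x + y) f = ins x f + ins y f" "ins (scale a x) f = smul a (ins x f)"
    "ins x (ins x f) = 0"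
    by (simp_all add: fun_eq_iff ins_apply smul_apply)
qed

text \<open>Polarisation: expand the double contraction by \<open>x + y\<close>, which
  vanishes.\<close>

lemma alternating_swap:
  assumes "alternating f"
  shows "ins x (ins y f) = - ins y (ins x f)"
proof -
  have "ins (x + y) (ins (x + y) f) = 0"
    using assms by (rule alternating_head)
  then have "ins x (ins y f) + ins y (ins x f) = 0"
    using assms by (simp add: alternating_head alternating_ins add.commute)
  then show ?thesis by (simp add: eq_neg_iff_add_eq_0)
qed

lemma alternating_ins_zero: "alternating f \<Longrightarrow> ins 0 f = 0"
  using alternating_head(1) [of f 0 0] by simp

lemma alternating_ins_minus: "alternating f \<Longrightarrow> ins (- x) f = - ins x f"
  using alternating_head(1) [of f x "- x"]
  by (simp add: alternating_ins_zero eq_neg_iff_add_eq_0 add.commute)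

lemma alternating_ins_diff: "alternating f \<Longrightarrow> ins (x - y) f = ins x f - ins y f"
  using alternating_head(1) [of f x "- y"] by (simp add: alternating_ins_minus)

lemma alternating_zero: "alternating 0"
  by (simp add: alternating_def)

lemma alternating_add: "alternating f \<Longrightarrow> alternating g \<Longrightarrow> alternating (f + g)"
  by (simp add: alternating_def algebra_simps)

lemma alternating_smul: "alternating f \<Longrightarrow> alternating (smul a f)"
  by (simp add: alternating_def smul_def algebra_simps)

lemma alternating_minus: "alternating f \<Longrightarrow> alternating (- f)"
  by (simp add: alternating_def)

lemma alternating_grade_sign: "alternating f \<Longrightarrow> alternating (grade_sign f)"
  by (simp add: alternating_def grade_sign_apply)

lemma alternating_const_form: "alternating (const_form a)"
  by (simp add: alternating_def const_form_def)

text \<open>Coinduction is up to binary sums because the contraction of a product, of a Lie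
  derivative and of a differential is a sum of two terms.\<close>

lemma alternating_coinduct:
  assumes "f \<in> X"
    and add: "\<And>f x y. f \<in> X \<Longrightarrow> ins (x + y) f = ins x f + ins y f"
    and hom: "\<And>f a x. f \<in> X \<Longrightarrow> ins (scale a x) f = smul a (ins x f)"
    and alt: "\<And>f x. f \<in> X \<Longrightarrow> ins x (ins x f) = 0"
    and step: "\<And>f x. f \<in> X \<Longrightarrow> \<exists>g h. ins x f = g + h \<and> g \<in> X \<union> Collect alternating \<and>
                 h \<in> X \<union> Collect alternating"
  shows "alternating f"
proof -
  let ?Y = "X \<union> Collect alternating"
  \<comment> \<open>Alternating functions satisfy the step condition with \<open>0\<close> as second
    summand. So \<open>?Y\<close> is closed under contraction up to sums, and the induction on the
    prefix \<open>us\<close> below can strip one entry at a time.\<close>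
  have step': "\<exists>g h. (\<forall>ws. f (x # ws) = g ws + h ws) \<and> g \<in> ?Y \<and> h \<in> ?Y" if f: "f \<in> ?Y" for f x
  proof (cases "f \<in> X")
    case True
    from step [OF this, of x] show ?thesis
      by (metis ins_apply plus_fun_apply)
  next
    case False
    with f have "alternating f" by simp
    then have "(\<forall>ws. f (x # ws) = ins x f ws + 0 ws)" "ins x f \<in> ?Y" "0 \<in> ?Y"
      by (simp_all add: ins_apply alternating_ins alternating_zero)
    then show ?thesis by blast
  qed
  have head: "f ((x + y) # vs) = f (x # vs) + f (y # vs)"
    "f (scale a x # vs) = a * f (x # vs)" "f (x # x # vs) = 0" if f: "f \<in> ?Y" for f x y a vs
  proof -
    have "ins (x + y) f = ins x f + ins y f" "ins (scale a x) f = smul a (ins x f)"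
      "ins x (ins x f) = 0"
      using f add hom alt alternating_head by blast+
    then show "f ((x + y) # vs) = f (x # vs) + f (y # vs)"
      "f (scale a x # vs) = a * f (x # vs)" "f (x # x # vs) = 0"
      by (metis ins_apply plus_fun_apply, metis ins_apply smul_apply, metis ins_apply zero_fun_apply)
  qed
  have "f (us @ (x + y) # vs) = f (us @ x # vs) + f (us @ y # vs) \<and>
      f (us @ scale a x # vs) = a * f (us @ x # vs) \<and> f (us @ x # x # vs) = 0"
    if "f \<in> ?Y" for f us x y a vs
    using that
  proof (induction us arbitrary: f)
    case Nil
    then show ?case by (simp only: append_Nil head simp_thms)
  next
    case (Cons u us)
    obtain g h where "\<forall>ws. f (u # ws) = g ws + h ws" "g \<in> ?Y" "h \<in> ?Y"
      using step' [OF Cons.prems] by blast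
    with Cons.IH [of g] Cons.IH [of h] show ?case
      by (simp add: algebra_simps)
  qed
  with \<open>f \<in> X\<close> show ?thesis unfolding alternating_def by blast
qed

text \<open>A contracted product is a sum of two products of alternating functions. In a double
  contraction by \<open>x\<close> the two mixed terms cancel, since contraction anticommutes with
  \<open>grade_sign\<close>.\<close>

lemma alternating_shuf:
  assumes "alternating f" "alternating g"
  shows "alternating (shuf f g)"
proof (rule alternating_coinduct)
  show "shuf f g \<in> {shuf f g |f g. alternating f \<and> alternating g}"
    using assms by blast
next
  fix f g x
  assume "f \<in> {shuf f g |f g. alternating f \<and> alternating g}"
  then show "\<exists>h h'. ins x f = h + h' \<and>
      h \<in> {shuf f g |f g. alternating f \<and> alternating g} \<union> Collect alternating \<and>
      h' \<in> {shuf f g |f g. alternating f \<and> alternating g} \<union> Collect alternating"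
    by (force simp: alternating_ins alternating_grade_sign)
qed (auto simp: alternating_head alternating_ins algebra_simps)

end

text \<open>Used in the inductions below: commuting \<open>ins x\<close> past the operators by
  rewriting reduces an identity on \<open>x # xs\<close> to the induction hypothesis on
  \<open>xs\<close>.\<close>

lemma Cons_eqI: "ins x f xs = ins x g xs \<Longrightarrow> f (x # xs) = g (x # xs)"
  by (simp add: ins_apply)

subsection \<open>Cartan calculus\<close>

text \<open>The part of a Lie-Rinehart structure that a graded derivation yields before
  \<open>dd = 0\<close> is imposed. The calculus developed here therefore applies to a reconstructed
  bracket whose Jacobi identity is still to be proved.\<close>

locale pre_lie_rinehart = unital_module scale
  for scale :: "'a::{comm_ring, comm_monoid_mult} \<Rightarrow> 'l::ab_group_add \<Rightarrow> 'l" +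
  fixes br :: "'l \<Rightarrow> 'l \<Rightarrow> 'l" and anchor :: "'l \<Rightarrow> 'a \<Rightarrow> 'a"
  assumes br_add_left: "br (x + y) z = br x z + br y z"
    and br_add_right: "br x (y + z) = br x y + br x z"
    and br_self: "br x x = 0"
    and br_scale_right: "br x (scale a y) = scale (anchor x a) y + scale a (br x y)"
    and anchor_add: "anchor x (a + b) = anchor x a + anchor x b"
    and anchor_mult: "anchor x (a * b) = anchor x a * b + a * anchor x b"
    and anchor_add_left: "anchor (x + y) a = anchor x a + anchor y a"
    and anchor_scale_left: "anchor (scale b x) a = b * anchor x a"
begin

lemma br_swap: "br x y = - br y x"
proof -
  have "br (x + y) (x + y) = br x y + br y x"
    by (simp only: br_add_left) (simp add: br_add_right br_self add.commute)
  then have "br x y + br y x = 0" by (simp only: br_self)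
  then show ?thesis by (simp add: eq_neg_iff_add_eq_0)
qed

lemma scale_minus_right: "scale a (- x) = - scale a x"
  by (metis add.right_inverse add_cancel_right_right minus_unique scale_add_right)

lemma br_scale_left: "br (scale a x) y = scale a (br x y) - scale (anchor y a) x"
  by (metis br_swap br_scale_right minus_add_distrib scale_minus_right add.commute
      diff_conv_add_uminus)

lemma anchor_zero [simp]: "anchor x 0 = 0"
  using anchor_add [of x 0 0] by simp

lemma anchor_minus: "anchor x (- a) = - anchor x a"
  using anchor_add [of x a "- a"] by (simp add: eq_neg_iff_add_eq_0 add.commute)

lemma anchor_diff: "anchor x (a - b) = anchor x a - anchor x b"
  using anchor_add [of x a "- b"] by (simp add: anchor_minus)

text \<open>The Lie derivative along \<open>x\<close>, encoded by its commutator with contraction;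
  \<open>lder_eq_sum\<close> gives the closed form on alternating functions.\<close>

primrec lder :: "'l \<Rightarrow> ('l list \<Rightarrow> 'a) \<Rightarrow> 'l list \<Rightarrow> 'a" where
  "lder x f [] = anchor x (f [])"
| "lder x f (y # ys) = lder x (ins y f) ys - f (br x y # ys)"

text \<open>\<open>cce\<close> is \<open>grade_sign\<close> of the following operator (lemma \<open>cce_eq\<close>).\<close>

primrec cder :: "('l list \<Rightarrow> 'a) \<Rightarrow> 'l list \<Rightarrow> 'a" where
  "cder f [] = 0"
| "cder f (x # xs) = lder x f xs - cder (ins x f) xs"

lemma ins_lder [simp]: "ins y (lder x f) = lder x (ins y f) - ins (br x y) f"
  by (simp add: fun_eq_iff ins_apply)

lemma ins_cder [simp]: "ins x (cder f) = lder x f - cder (ins x f)"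
  by (simp add: fun_eq_iff ins_apply)

lemma lder_simps [simp]:
  "lder x (f + g) = lder x f + lder x g"
  "lder x (- f) = - lder x f"
  "lder x (f - g) = lder x f - lder x g"
  "lder x 0 = 0"
  "lder x (smul a f) = smul (anchor x a) f + smul a (lder x f)"
  "lder x (grade_sign f) = grade_sign (lder x f)"
proof -
  show add: "lder x (f + g) = lder x f + lder x g" for f g
  proof
    fix xs show "lder x (f + g) xs = (lder x f + lder x g) xs"
      by (induction xs arbitrary: f g) (simp_all add: anchor_add)
  qed
  show minus: "lder x (- f) = - lder x f" for f
  proof
    fix xs show "lder x (- f) xs = (- lder x f) xs"
      by (induction xs arbitrary: f) (simp_all add: anchor_minus)
  qed
  show "lder x (f - g) = lder x f - lder x g"
    using add [of f "- g"] by (simp add: minus)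
  show "lder x 0 = 0"
    using add [of 0 0] by simp
  show "lder x (smul a f) = smul (anchor x a) f + smul a (lder x f)"
  proof
    fix xs show "lder x (smul a f) xs = (smul (anchor x a) f + smul a (lder x f)) xs"
      by (induction xs arbitrary: f) (simp_all add: anchor_mult smul_apply ins_apply algebra_simps)
  qed
  show "lder x (grade_sign f) = grade_sign (lder x f)"
  proof
    fix xs show "lder x (grade_sign f) xs = grade_sign (lder x f) xs"
      by (induction xs arbitrary: f)
        (simp_all add: minus grade_sign_apply ins_apply split: if_splits)
  qed
qed

lemma lder_shuf [simp]: "lder x (shuf f g) = shuf (lder x f) g + shuf f (lder x g)"
proof
  fix xs show "lder x (shuf f g) xs = (shuf (lder x f) g + shuf f (lder x g)) xs"
  proof (induction xs arbitrary: f g)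
    case (Cons y ys)
    have "ins y (lder x (shuf f g)) ys = ins y (shuf (lder x f) g + shuf f (lder x g)) ys"
      by (simp add: Cons)
    then show ?case by (rule Cons_eqI)
  qed (simp add: anchor_mult)
qed

lemma cder_simps [simp]:
  "cder (f + g) = cder f + cder g"
  "cder (- f) = - cder f"
  "cder (f - g) = cder f - cder g"
  "cder 0 = 0"
  "cder (grade_sign f) = - grade_sign (cder f)"
proof -
  show add: "cder (f + g) = cder f + cder g" for f g
  proof
    fix xs show "cder (f + g) xs = (cder f + cder g) xs"
      by (induction xs arbitrary: f g) simp_all
  qed
  show minus: "cder (- f) = - cder f" for f
  proof
    fix xs show "cder (- f) xs = (- cder f) xs"
      by (induction xs arbitrary: f) simp_all
  qed
  show "cder (f - g) = cder f - cder g"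
    using add [of f "- g"] by (simp add: minus)
  show "cder 0 = 0"
    using add [of 0 0] by simp
  show "cder (grade_sign f) = - grade_sign (cder f)"
  proof
    fix xs show "cder (grade_sign f) xs = (- grade_sign (cder f)) xs"
    proof (induction xs arbitrary: f)
      case (Cons y ys)
      have "ins y (cder (grade_sign f)) ys = ins y (- grade_sign (cder f)) ys"
        by (simp add: Cons minus)
      then show ?case by (rule Cons_eqI)
    qed (simp add: grade_sign_apply)
  qed
qed

lemma cder_shuf [simp]: "cder (shuf f g) = shuf (cder f) g + shuf (grade_sign f) (cder g)"
proof
  fix xs show "cder (shuf f g) xs = (shuf (cder f) g + shuf (grade_sign f) (cder g)) xs"
  proof (induction xs arbitrary: f g)
    case (Cons y ys)
    \<comment> \<open>Contracting the product puts \<open>grade_sign f\<close> into the left factor;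
      moving the differential past \<open>grade_sign\<close> produces the sign of the antiderivation
      rule.\<close>
    have "shuf (cder (grade_sign f)) h = - shuf (grade_sign (cder f)) h" for h
      by (simp only: cder_simps shuf_simps)
    then have "ins y (cder (shuf f g)) ys =
        ins y (shuf (cder f) g + shuf (grade_sign f) (cder g)) ys"
      by (simp add: Cons del: cder_simps(5))
    then show ?case by (rule Cons_eqI)
  qed simp
qed

lemma lder_const_form [simp]: "lder x (const_form a) = const_form (anchor x a)"
proof
  fix xs show "lder x (const_form a) xs = const_form (anchor x a) xs"
    by (cases xs) simp_all
qed

lemma cder_smul: "cder (smul a f) = shuf (cder (const_form a)) f + smul a (cder f)"
  using cder_shuf [of "const_form a" f] by simp

lemma grade_sign_cder_const_form: "grade_sign (cder (const_form a)) = - cder (const_form a)"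
  using cder_simps(5) [of "const_form a"] unfolding grade_sign_const_form
  by (rule equation_minus_iff [THEN iffD1])

text \<open>The failure of \<open>lder\<close> to be linear in \<open>x\<close> comes from the
  derivative term of \<open>br_scale_left\<close>, collected over all arguments into a product with
  the differential of \<open>a\<close>.\<close>

lemma lder_scale_left:
  assumes "alternating f"
  shows "lder (scale a x) f = smul a (lder x f) + shuf (cder (const_form a)) (ins x f)"
proof
  fix xs
  show "lder (scale a x) f xs = (smul a (lder x f) + shuf (cder (const_form a)) (ins x f)) xs"
    using assms
  proof (induction xs arbitrary: f)
    case Nil
    then show ?case by (simp add: anchor_scale_left smul_apply)
  next
    case (Cons y ys)
    have "ins (br (scale a x) y) f = smul a (ins (br x y) f) - smul (anchor y a) (ins x f)"
      using Cons.prems by (simp add: br_scale_left alternating_ins_diff alternating_head)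
    then have "ins y (lder (scale a x) f) ys =
        ins y (smul a (lder x f) + shuf (cder (const_form a)) (ins x f)) ys"
      by (simp add: Cons alternating_ins alternating_swap [OF Cons.prems, of y x]
          grade_sign_cder_const_form)
    then show ?case by (rule Cons_eqI)
  qed
qed

lemma lder_add_left:
  assumes "alternating f"
  shows "lder (x + y) f = lder x f + lder y f"
proof
  fix xs
  show "lder (x + y) f xs = (lder x f + lder y f) xs"
    using assms
  proof (induction xs arbitrary: f)
    case (Cons z zs)
    then have "ins z (lder (x + y) f) zs = ins z (lder x f + lder y f) zs"
      by (simp add: alternating_ins alternating_head br_add_left)
    then show ?case by (rule Cons_eqI)
  qed (simp add: anchor_add_left)
qed

text \<open>Homogeneity holds because the derivative of the coefficient in \<open>lder_simps\<close>
  cancels against the derivative term of \<open>br_scale_right\<close>; in a double contraction the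
  two bracket terms cancel by \<open>alternating_swap\<close>.\<close>

lemma alternating_lder:
  assumes "alternating f"
  shows "alternating (lder x f)"
proof (rule alternating_coinduct)
  show "lder x f \<in> {lder x f |f. alternating f}"
    using assms by blast
next
  fix f y
  assume "f \<in> {lder x f |f. alternating f}"
  then obtain g where "f = lder x g" "alternating g" by blast
  then have "ins y f = lder x (ins y g) + - ins (br x y) g" "alternating (ins y g)"
    "alternating (- ins (br x y) g)"
    by (auto intro: alternating_ins alternating_minus)
  then show "\<exists>h h'. ins y f = h + h' \<and>
      h \<in> {lder x f |f. alternating f} \<union> Collect alternating \<and>
      h' \<in> {lder x f |f. alternating f} \<union> Collect alternating"
    by blast
next
  fix f y
  assume "f \<in> {lder x f |f. alternating f}"
  then obtain g where "f = lder x g" "alternating g" by blast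
  then show "ins y (ins y f) = 0"
    by (simp add: alternating_head alternating_ins alternating_swap [of g "br x y" y])
qed (auto simp: alternating_head alternating_ins br_add_right br_scale_right)

text \<open>By Cartan's formula, the product with the differential of \<open>a\<close> in
  \<open>lder_scale_left\<close> cancels the one in \<open>cder_smul\<close>. In a double
  contraction by \<open>y\<close> the Lie derivatives cancel and the bracket term dies by
  \<open>br_self\<close>.\<close>

lemma alternating_cder:
  assumes "alternating f"
  shows "alternating (cder f)"
proof (rule alternating_coinduct)
  show "cder f \<in> {cder f |f. alternating f}"
    using assms by blast
next
  fix f y
  assume "f \<in> {cder f |f. alternating f}"
  then obtain g where "f = cder g" "alternating g" by blast
  then have "ins y f = lder y g + cder (- ins y g)" "alternating (lder y g)"
    "alternating (- ins y g)"
    by (auto intro: alternating_ins alternating_minus alternating_lder)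
  then show "\<exists>h h'. ins y f = h + h' \<and>
      h \<in> {cder f |f. alternating f} \<union> Collect alternating \<and>
      h' \<in> {cder f |f. alternating f} \<union> Collect alternating"
    by blast
qed (auto simp: alternating_head alternating_ins lder_add_left lder_scale_left cder_smul
      br_self alternating_ins_zero algebra_simps)

section \<open>The Jacobi identity and the square of the differential\<close>

definition lie_rinehart :: bool where
  "lie_rinehart \<longleftrightarrow> (\<forall>x y a. anchor (br x y) a = anchor x (anchor y a) - anchor y (anchor x a)) \<and>
     (\<forall>x y z. br x (br y z) + br y (br z x) + br z (br x y) = 0)"

lemma br_minus_right: "br x (- y) = - br x y"
  using br_add_right [of x y "- y"] br_add_right [of x 0 0]
  by (simp add: eq_neg_iff_add_eq_0 add.commute)

lemma lie_rinehart_br_br: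
  assumes lie_rinehart
  shows "br (br x y) z = br x (br y z) - br y (br x z)"
proof -
  have "br x (br y z) + br y (br z x) + br z (br x y) = 0"
    using assms by (simp add: lie_rinehart_def)
  moreover have "br z (br x y) = - br (br x y) z" "br y (br z x) = - br y (br x z)"
    by (rule br_swap) (simp add: br_swap [of z x] br_minus_right)
  ultimately show ?thesis by (simp add: algebra_simps)
qed

text \<open>On the empty list this is the anchor being a Lie morphism; the induction step is the
  Jacobi identity in the form \<open>lie_rinehart_br_br\<close>.\<close>

lemma lder_lder:
  assumes lie_rinehart "alternating f"
  shows "lder x (lder y f) - lder y (lder x f) = lder (br x y) f"
proof
  fix xs
  show "(lder x (lder y f) - lder y (lder x f)) xs = lder (br x y) f xs"
    using assms(2)
  proof (induction xs arbitrary: f)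
    case Nil
    then show ?case using assms(1) by (simp add: lie_rinehart_def)
  next
    case (Cons z zs)
    have IH: "lder (br x y) (ins z f) zs =
        lder x (lder y (ins z f)) zs - lder y (lder x (ins z f)) zs"
      using Cons.IH [OF alternating_ins, OF Cons.prems, of z] by simp
    have "ins z (lder x (lder y f) - lder y (lder x f)) zs = ins z (lder (br x y) f) zs"
      by (simp add: IH lie_rinehart_br_br [OF assms(1)] alternating_ins_diff [OF Cons.prems])
    then show ?case by (rule Cons_eqI)
  qed
qed

text \<open>Contracting both sides by \<open>y\<close> with Cartan's formula leaves the commutator
  \<open>lder_lder\<close> and the same identity for \<open>ins y f\<close>.\<close>

lemma lder_cder:
  assumes lie_rinehart "alternating f"
  shows "lder x (cder f) = cder (lder x f)"
proof
  fix xs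
  show "lder x (cder f) xs = cder (lder x f) xs"
    using assms(2)
  proof (induction xs arbitrary: f)
    case (Cons y ys)
    have "ins y (lder x (cder f)) ys = ins y (cder (lder x f)) ys"
      using Cons.IH [OF alternating_ins, OF Cons.prems, of y] lder_lder [OF assms(1) Cons.prems, of x y]
      by (simp add: fun_eq_iff algebra_simps)
    then show ?case by (rule Cons_eqI)
  qed simp
qed

text \<open>Cartan's formula twice: the contraction of \<open>cder (cder f)\<close> is the
  commutator from \<open>lder_cder\<close>, which vanishes, plus
  \<open>cder (cder (ins y f))\<close>.\<close>

lemma cder_cder:
  assumes lie_rinehart "alternating f"
  shows "cder (cder f) = 0"
proof
  fix xs
  show "cder (cder f) xs = 0 xs"
    using assms(2)
  proof (induction xs arbitrary: f)
    case (Cons y ys)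
    have "ins y (cder (cder f)) ys = ins y 0 ys"
      using Cons.IH [OF alternating_ins, OF Cons.prems, of y]
      by (simp add: lder_cder [OF assms(1) Cons.prems])
    then show ?case by (rule Cons_eqI)
  qed simp
qed

end

subsection \<open>Recursion for shuffle permutations\<close>

definition lift_perm :: "(nat \<Rightarrow> nat) \<Rightarrow> nat \<Rightarrow> nat" where
  "lift_perm \<tau> i = (case i of 0 \<Rightarrow> 0 | Suc j \<Rightarrow> Suc (\<tau> j))"

lemma lift_perm_simps [simp]: "lift_perm \<tau> 0 = 0" "lift_perm \<tau> (Suc j) = Suc (\<tau> j)"
  by (simp_all add: lift_perm_def)

lemma lift_perm_eq_iff: "lift_perm \<sigma> = lift_perm \<tau> \<longleftrightarrow> \<sigma> = \<tau>"
proof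
  assume *: "lift_perm \<sigma> = lift_perm \<tau>"
  show "\<sigma> = \<tau>"
  proof
    fix i show "\<sigma> i = \<tau> i" using fun_cong [OF *, of "Suc i"] by simp
  qed
qed simp

text \<open>Presents \<open>lift_perm\<close> as transport along the injection \<open>Suc\<close>,
  from which permutation property and parity are inherited.\<close>

lemma lift_perm_eq_map_permutation:
  assumes "\<tau> permutes {..<n}"
  shows "lift_perm \<tau> = map_permutation {..<n} Suc \<tau>"
proof
  fix i show "lift_perm \<tau> i = map_permutation {..<n} Suc \<tau> i"
  proof (cases i)
    case 0
    then show ?thesis by (simp add: map_permutation_def restrict_id_def)
  next
    case (Suc j)
    show ?thesis
    proof (cases "j < n")
      case True
      then show ?thesis using Suc by (simp add: map_permutation_apply)
    next
      case False
      then show ?thesis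
        using Suc assms by (auto simp: map_permutation_def restrict_id_def permutes_def)
    qed
  qed
qed

lemma lift_perm_permutes:
  assumes "\<tau> permutes {..<n}"
  shows "lift_perm \<tau> permutes {..<Suc n}" and "evenperm (lift_perm \<tau>) = evenperm \<tau>"
proof -
  have "lift_perm \<tau> permutes Suc ` {..<n}"
    unfolding lift_perm_eq_map_permutation [OF assms]
    using assms by (intro map_permutation_permutes) (auto simp: bij_betw_def)
  then show "lift_perm \<tau> permutes {..<Suc n}"
    by (rule permutes_subset) auto
  show "evenperm (lift_perm \<tau>) = evenperm \<tau>"
    unfolding lift_perm_eq_map_permutation [OF assms]
    using assms by (intro evenperm_map_permutation) auto
qed

lemma permutes_fixing_zeroE:
  assumes "\<sigma> permutes {..<Suc n}" "\<sigma> 0 = 0"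
  obtains \<tau> where "\<tau> permutes {..<n}" "\<sigma> = lift_perm \<tau>"
proof
  \<comment> \<open>The truncated subtraction is exact: \<open>\<sigma>\<close> is injective and
    already takes the value 0 at 0.\<close>
  define \<tau> where "\<tau> j = \<sigma> (Suc j) - 1" for j
  have inj: "inj \<sigma>" using assms(1) by (rule permutes_inj)
  have nz: "\<sigma> (Suc j) = Suc (\<tau> j)" for j
    using inj_eq [OF inj, of "Suc j" 0] assms(2) by (simp add: \<tau>_def)
  show eq: "\<sigma> = lift_perm \<tau>"
  proof
    fix i show "\<sigma> i = lift_perm \<tau> i" by (cases i) (simp_all add: assms(2) nz)
  qed
  have "inj \<tau>"
  proof (rule injI)
    fix i j assume "\<tau> i = \<tau> j"
    then have "\<sigma> (Suc i) = \<sigma> (Suc j)" by (simp add: nz)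
    then show "i = j" using inj by (simp add: inj_eq)
  qed
  moreover have "\<tau> j = j" if "j \<notin> {..<n}" for j
    using nz [of j] permutes_not_in [OF assms(1), of "Suc j"] that by simp
  moreover have "\<tau> ` {..<n} \<subseteq> {..<n}"
  proof
    fix i assume "i \<in> \<tau> ` {..<n}"
    then obtain j where "j < n" "i = \<tau> j" by auto
    then show "i \<in> {..<n}"
      using nz [of j] permutes_in_image [OF assms(1), of "Suc j"] by simp
  qed
  ultimately show "\<tau> permutes {..<n}"
    by (intro bij_imp_permutes bij_betw_imageI endo_inj_surj) (auto intro: inj_on_subset)
qed

text \<open>The cycle of length \<open>p + 1\<close> that brings position \<open>p\<close>, the head
  of the second block, to the front and keeps the order of the first block. Its parity is the sign
  picked up when a contraction passes a form of \<open>p\<close> variables.\<close>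

definition front_cycle :: "nat \<Rightarrow> nat \<Rightarrow> nat" where
  "front_cycle p i = (if i < p then Suc i else if i = p then 0 else i)"

lemma front_cycle_permutes:
  "front_cycle p permutes {..p}" "evenperm (front_cycle p) = even p"
proof (induction p)
  case 0
  have "front_cycle 0 = id" by (auto simp: front_cycle_def)
  then show "front_cycle 0 permutes {..0}" "evenperm (front_cycle 0) = even 0"
    by (simp_all add: permutes_id)
next
  case (Suc p)
  have eq: "front_cycle (Suc p) = front_cycle p \<circ> Transposition.transpose p (Suc p)"
    by (auto simp: front_cycle_def Transposition.transpose_def fun_eq_iff)
  show "front_cycle (Suc p) permutes {..Suc p}"
    unfolding eq
    by (rule permutes_compose [OF permutes_swap_id permutes_subset [OF Suc(1)]]) auto
  show "evenperm (front_cycle (Suc p)) = even (Suc p)"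
    unfolding eq using Suc
    by (subst evenperm_comp)
      (auto simp: evenperm_swap permutation_swap_id intro: permutation_permutes [THEN iffD2])
qed

lemma finite_shuffle_perms: "finite (shuffle_perms p q)"
  by (rule finite_subset [OF _ finite_permutations [of "{..<p + q}"]])
    (auto simp: shuffle_perms_def)

lemma shuffle_perms_permutes: "\<sigma> \<in> shuffle_perms p q \<Longrightarrow> \<sigma> permutes {..<p + q}"
  by (simp add: shuffle_perms_def)

lemma shuffle_perms_zero: "shuffle_perms 0 0 = {id}"
  by (auto simp: shuffle_perms_def permutes_id)

text \<open>A shuffle takes the value 0 at the first position of one of its two increasing blocks.\<close>

abbreviation first_low :: "nat \<Rightarrow> nat \<Rightarrow> (nat \<Rightarrow> nat) set" where
  "first_low p q \<equiv> (if p = 0 then {} else lift_perm ` shuffle_perms (p - 1) q)"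

abbreviation first_high :: "nat \<Rightarrow> nat \<Rightarrow> (nat \<Rightarrow> nat) set" where
  "first_high p q \<equiv>
     (if q = 0 then {} else (\<lambda>\<tau>. lift_perm \<tau> \<circ> front_cycle p) ` shuffle_perms p (q - 1))"

lemma strict_mono_on_image_Suc: "strict_mono_on (Suc ` A) f \<longleftrightarrow> strict_mono_on A (\<lambda>i. f (Suc i))"
  unfolding strict_mono_on_def by (safe; blast intro: Suc_mono)

lemma strict_mono_on_Suc_comp: "strict_mono_on A (\<lambda>i. Suc (f i)) \<longleftrightarrow> strict_mono_on A f"
  by (simp add: strict_mono_on_def)

lemma strict_mono_on_insert_less:
  fixes f :: "'i::order \<Rightarrow> 'j::order"
  assumes "\<And>b. b \<in> B \<Longrightarrow> m < b"
  shows "strict_mono_on (insert m B) f \<longleftrightarrow> (\<forall>b\<in>B. f m < f b) \<and> strict_mono_on B f"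
proof
  assume "(\<forall>b\<in>B. f m < f b) \<and> strict_mono_on B f"
  then show "strict_mono_on (insert m B) f"
    using assms by (intro strict_mono_onI) (auto dest: strict_mono_onD less_asym)
qed (use assms in \<open>auto simp: strict_mono_on_def\<close>)

lemma lift_perm_mem_shuffle_perms:
  assumes "\<tau> permutes {..<p + q}"
  shows "lift_perm \<tau> \<in> shuffle_perms (Suc p) q \<longleftrightarrow> \<tau> \<in> shuffle_perms p q"
proof -
  have "{..<Suc p} = insert 0 (Suc ` {..<p})" "{Suc p..<Suc p + q} = Suc ` {p..<p + q}"
    by (simp_all add: lessThan_Suc_eq_insert_0)
  moreover have "strict_mono_on (insert 0 (Suc ` A)) (lift_perm \<tau>) \<longleftrightarrow> strict_mono_on A \<tau>"
    "strict_mono_on (Suc ` A) (lift_perm \<tau>) \<longleftrightarrow> strict_mono_on A \<tau>" for A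
    by (subst strict_mono_on_insert_less)
      (auto simp: strict_mono_on_image_Suc strict_mono_on_Suc_comp)
  ultimately have "strict_mono_on {..<Suc p} (lift_perm \<tau>) \<longleftrightarrow> strict_mono_on {..<p} \<tau>"
    "strict_mono_on {Suc p..<Suc p + q} (lift_perm \<tau>) \<longleftrightarrow> strict_mono_on {p..<p + q} \<tau>"
    by (simp_all only:)
  then show ?thesis
    using assms lift_perm_permutes(1) [OF assms] by (simp add: shuffle_perms_def)
qed

lemma lift_perm_front_cycle_simps [simp]:
  "i < p \<Longrightarrow> lift_perm \<tau> (front_cycle p i) = Suc (\<tau> i)"
  "lift_perm \<tau> (front_cycle p p) = 0"
  "p \<le> i \<Longrightarrow> lift_perm \<tau> (front_cycle p (Suc i)) = Suc (\<tau> i)"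
  by (simp_all add: front_cycle_def)

lemma lift_perm_front_cycle_permutes:
  assumes "\<tau> permutes {..<p + q}"
  shows "lift_perm \<tau> \<circ> front_cycle p permutes {..<Suc (p + q)}"
    and "evenperm (lift_perm \<tau> \<circ> front_cycle p) = (evenperm \<tau> = even p)"
proof -
  show "lift_perm \<tau> \<circ> front_cycle p permutes {..<Suc (p + q)}"
    by (rule permutes_compose [OF permutes_subset [OF front_cycle_permutes(1)]
          lift_perm_permutes(1) [OF assms]]) auto
  have "permutation (lift_perm \<tau>)" "permutation (front_cycle p)"
    using lift_perm_permutes(1) [OF assms] front_cycle_permutes(1) [of p]
    by (auto intro: permutation_permutes [THEN iffD2])
  then show "evenperm (lift_perm \<tau> \<circ> front_cycle p) = (evenperm \<tau> = even p)"
    by (simp add: evenperm_comp front_cycle_permutes(2) lift_perm_permutes(2) [OF assms])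
qed

lemma lift_perm_front_cycle_mem_shuffle_perms:
  assumes "\<tau> permutes {..<p + q}"
  shows "lift_perm \<tau> \<circ> front_cycle p \<in> shuffle_perms p (Suc q) \<longleftrightarrow> \<tau> \<in> shuffle_perms p q"
proof -
  let ?\<sigma> = "lift_perm \<tau> \<circ> front_cycle p"
  have "{p..<p + Suc q} = insert p (Suc ` {p..<p + q})"
    by auto
  moreover have "strict_mono_on {..<p} ?\<sigma> \<longleftrightarrow> strict_mono_on {..<p} \<tau>"
    by (auto simp: strict_mono_on_def)
  moreover have "strict_mono_on (insert p (Suc ` {p..<p + q})) ?\<sigma> \<longleftrightarrow>
      strict_mono_on {p..<p + q} \<tau>"
  proof -
    have "strict_mono_on (Suc ` {p..<p + q}) ?\<sigma> \<longleftrightarrow> strict_mono_on {p..<p + q} \<tau>"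
      unfolding strict_mono_on_image_Suc by (auto simp: strict_mono_on_def)
    then show ?thesis
      by (subst strict_mono_on_insert_less) (auto simp del: image_Suc_atLeastLessThan)
  qed
  ultimately show ?thesis
    using assms lift_perm_front_cycle_permutes(1) [OF assms] by (simp add: shuffle_perms_def)
qed

lemma shuffle_perms_split:
  assumes "p + q = Suc n"
  shows "shuffle_perms p q = first_low p q \<union> first_high p q"
proof (intro set_eqI iffI)
  fix \<sigma> assume \<sigma>: "\<sigma> \<in> shuffle_perms p q"
  then have perm: "\<sigma> permutes {..<Suc n}"
    and mono: "strict_mono_on {..<p} \<sigma>" "strict_mono_on {p..<p + q} \<sigma>"
    using assms by (auto simp: shuffle_perms_def)
  obtain i where i: "\<sigma> i = 0" "i < p + q"
    using permutes_image [OF perm] assms by (metis imageE lessThan_iff zero_less_Suc)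
  consider "i = 0" "p > 0" | "i = p" "q > 0"
  proof (cases "i < p")
    case True
    then have "i = 0"
      using strict_mono_onD [OF mono(1), of 0 i] i by (cases i) auto
    with True that show ?thesis by simp
  next
    case False
    have "\<not> p < i"
    proof
      assume "p < i"
      from strict_mono_onD [OF mono(2) _ _ this] i this show False by auto
    qed
    with False have "i = p" by (metis linorder_neqE_nat)
    with that(2) i show ?thesis by simp
  qed
  then show "\<sigma> \<in> first_low p q \<union> first_high p q"
  proof cases
    case 1
    then obtain p' where p': "p = Suc p'" by (cases p) auto
    obtain \<tau> where "\<tau> permutes {..<n}" "\<sigma> = lift_perm \<tau>"
      using permutes_fixing_zeroE [OF perm] i 1 by auto
    then show ?thesis
      using \<sigma> assms lift_perm_mem_shuffle_perms [of \<tau> p' q] by (auto simp: p')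
  next
    case 2
    then obtain q' where q': "q = Suc q'" by (cases q) auto
    have c: "front_cycle p permutes {..<Suc n}"
      using assms by (intro permutes_subset [OF front_cycle_permutes(1)]) (auto simp: q')
    \<comment> \<open>Cancelling the cycle on the right moves the preimage of 0 from
      \<open>p\<close> to 0, so the remaining permutation is a lift.\<close>
    have "inv (front_cycle p) 0 = p"
      using permutes_inverses(2) [OF c, of p] by (simp add: front_cycle_def)
    then have "(\<sigma> \<circ> inv (front_cycle p)) 0 = 0" using i 2 by simp
    then obtain \<tau> where \<tau>: "\<tau> permutes {..<n}" "\<sigma> \<circ> inv (front_cycle p) = lift_perm \<tau>"
      using permutes_fixing_zeroE [OF permutes_compose [OF permutes_inv [OF c] perm]] by metis
    have "\<sigma> = lift_perm \<tau> \<circ> front_cycle p"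
      using permutes_inv_o(2) [OF c] by (simp add: \<tau>(2) [symmetric] comp_assoc)
    then show ?thesis
      using \<tau>(1) \<sigma> assms lift_perm_front_cycle_mem_shuffle_perms [of \<tau> p q'] by (auto simp: q')
  qed
next
  fix \<sigma> assume "\<sigma> \<in> first_low p q \<union> first_high p q"
  then consider p' \<tau> where "p = Suc p'" "\<tau> \<in> shuffle_perms p' q" "\<sigma> = lift_perm \<tau>"
    | q' \<tau> where "q = Suc q'" "\<tau> \<in> shuffle_perms p q'" "\<sigma> = lift_perm \<tau> \<circ> front_cycle p"
    by (cases p; cases q) auto
  then show "\<sigma> \<in> shuffle_perms p q"
    by cases (simp_all only: lift_perm_mem_shuffle_perms
        lift_perm_front_cycle_mem_shuffle_perms shuffle_perms_permutes)
qed

lemma sum_shuffle_perms: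
  fixes F :: "(nat \<Rightarrow> nat) \<Rightarrow> 'a::comm_monoid_add"
  assumes "p + q = Suc n"
  shows "(\<Sum>\<sigma>\<in>shuffle_perms p q. F \<sigma>) =
    (if p = 0 then 0 else \<Sum>\<tau>\<in>shuffle_perms (p - 1) q. F (lift_perm \<tau>)) +
    (if q = 0 then 0 else \<Sum>\<tau>\<in>shuffle_perms p (q - 1). F (lift_perm \<tau> \<circ> front_cycle p))"
proof -
  have disj: "first_low p q \<inter> first_high p q = {}"
  proof -
    \<comment> \<open>Position \<open>p\<close> separates the two kinds: a lift is nonzero there,
      the other composite is 0. For \<open>p = 0\<close> the first set is empty.\<close>
    have "lift_perm \<tau> \<noteq> lift_perm \<tau>' \<circ> front_cycle p" if "p > 0" for \<tau> \<tau>'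
    proof
      assume "lift_perm \<tau> = lift_perm \<tau>' \<circ> front_cycle p"
      from fun_cong [OF this, of p] that show False by (cases p) simp_all
    qed
    then show ?thesis by auto
  qed
  have inj: "inj_on (\<lambda>\<tau>. lift_perm \<tau> \<circ> front_cycle p) A" for A
  proof (rule inj_onI)
    fix \<tau> \<tau>' assume "lift_perm \<tau> \<circ> front_cycle p = lift_perm \<tau>' \<circ> front_cycle p"
    then have "lift_perm \<tau> = lift_perm \<tau>'"
      using permutes_surj [OF front_cycle_permutes(1), of p] by (metis surj_fun_eq o_apply UNIV_I)
    then show "\<tau> = \<tau>'" by (simp add: lift_perm_eq_iff)
  qed
  have inj': "inj_on lift_perm A" for A by (auto simp: inj_on_def lift_perm_eq_iff)
  have "(\<Sum>\<sigma>\<in>shuffle_perms p q. F \<sigma>) = sum F (first_low p q) + sum F (first_high p q)"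
    unfolding shuffle_perms_split [OF assms]
    by (rule sum.union_disjoint [OF _ _ disj]) (simp_all add: finite_shuffle_perms)
  then show ?thesis
    by (simp add: sum.reindex [OF inj] sum.reindex [OF inj'])
qed

text \<open>The first argument \<open>x\<close> goes to the form whose block contains the preimage
  of 0. Splitting the shuffles accordingly gives the recursion of \<open>shuf\<close>, with the sign
  coming from the parity of \<open>front_cycle p\<close>.\<close>

lemma wedge_Cons:
  assumes "p + q = Suc (length ys)"
  shows "wedge p q f g (x # ys) =
    (if p = 0 then 0 else wedge (p - 1) q (ins x f) g ys) +
    (if q = 0 then 0 else (- 1) ^ p * wedge p (q - 1) f (ins x g) ys)"
proof -
  let ?F = "\<lambda>\<sigma>. (if evenperm \<sigma> then 1 else - 1) *
    (f (map (\<lambda>i. (x # ys) ! \<sigma> i) [0..<p]) * g (map (\<lambda>i. (x # ys) ! \<sigma> i) [p..<p + q]))"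
  have L: "wedge (p - 1) q (ins x f) g ys = (\<Sum>\<tau>\<in>shuffle_perms (p - 1) q. ?F (lift_perm \<tau>))"
    if p0: "p \<noteq> 0"
  proof -
    obtain p' where p: "p = Suc p'" using p0 by (cases p) auto
    have "map (\<lambda>i. (x # ys) ! lift_perm \<tau> i) [0..<p] = x # map (\<lambda>i. ys ! \<tau> i) [0..<p']" for \<tau>
      by (simp add: p map_upt_Suc del: upt_Suc)
    moreover have "map (\<lambda>i. (x # ys) ! lift_perm \<tau> i) [p..<p + q] =
        map (\<lambda>i. ys ! \<tau> i) [p'..<p' + q]" for \<tau>
      by (simp add: p map_Suc_upt [symmetric] del: upt_Suc)
    ultimately show ?thesis
      using assms unfolding wedge_def
      by (auto simp: p ins_apply lift_perm_permutes(2) [OF shuffle_perms_permutes] intro!: sum.cong)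
  qed
  have H: "(- 1) ^ p * wedge p (q - 1) f (ins x g) ys =
      (\<Sum>\<tau>\<in>shuffle_perms p (q - 1). ?F (lift_perm \<tau> \<circ> front_cycle p))" if q0: "q \<noteq> 0"
  proof -
    obtain q' where q: "q = Suc q'" using q0 by (cases q) auto
    have 1: "map (\<lambda>i. (x # ys) ! (lift_perm \<tau> \<circ> front_cycle p) i) [0..<p] =
        map (\<lambda>i. ys ! \<tau> i) [0..<p]" for \<tau>
      by simp
    have "map (\<lambda>i. (x # ys) ! (lift_perm \<tau> \<circ> front_cycle p) i) [p..<p + q] =
        x # map (\<lambda>i. (x # ys) ! (lift_perm \<tau> \<circ> front_cycle p) (Suc i)) [p..<p + q']" for \<tau>
      by (simp add: q upt_conv_Cons [of p] map_Suc_upt [symmetric] del: upt_Suc)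
    then have 2: "map (\<lambda>i. (x # ys) ! (lift_perm \<tau> \<circ> front_cycle p) i) [p..<p + q] =
        x # map (\<lambda>i. ys ! \<tau> i) [p..<p + q']" for \<tau>
      by simp
    show ?thesis
      using assms unfolding wedge_def 1 2
      by (auto simp: q ins_apply sum_distrib_left minus_one_power_mult
          lift_perm_front_cycle_permutes(2) [OF shuffle_perms_permutes] intro!: sum.cong)
  qed
  have "wedge p q f g (x # ys) = (\<Sum>\<sigma>\<in>shuffle_perms p q. ?F \<sigma>)"
    by (simp only: wedge_def length_Cons assms simp_thms if_True)
  then show ?thesis
    unfolding sum_shuffle_perms [OF assms, of ?F]
    by (simp only: L H simp_thms cong: if_cong)
qed

section \<open>Homogeneous components and comparison of the products\<close>

lemma component_apply: "component m f xs = (if length xs = m then f xs else 0)"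
  by (simp add: component_def)

lemma component_eqD: "component m f = f \<Longrightarrow> length xs \<noteq> m \<Longrightarrow> f xs = 0"
  by (metis component_apply)

lemma ins_component [simp]:
  "ins x (component 0 f) = 0"
  "ins x (component (Suc m) f) = component m (ins x f)"
  by (simp_all add: fun_eq_iff ins_apply component_apply)

lemma component_ins:
  assumes "component m f = f"
  shows "m = 0 \<Longrightarrow> ins x f = 0" and "component (m - 1) (ins x f) = ins x f"
  using component_eqD [OF assms]
  by (auto simp: fun_eq_iff ins_apply component_apply)

lemma grade_sign_component:
  assumes "component m f = f"
  shows "grade_sign f = smul ((- 1) ^ m) f"
proof
  fix xs show "grade_sign f xs = smul ((- 1) ^ m) f xs"
    using component_eqD [OF assms, of xs]
    by (cases "length xs = m") (simp_all add: smul_apply minus_one_power_mult grade_sign_apply)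
qed

text \<open>Both sides satisfy the same recursion, because \<open>grade_sign\<close> acts on a
  function of \<open>p\<close> variables as the sign in \<open>wedge_Cons\<close>.\<close>

lemma shuf_eq_wedge:
  assumes "component p f = f" "component q g = g"
  shows "shuf f g xs = wedge p q f g xs"
  using assms
proof (induction xs arbitrary: f g p q)
  case Nil
  show ?case
  proof (cases "p = 0 \<and> q = 0")
    case True
    then show ?thesis by (simp add: wedge_def shuffle_perms_zero)
  next
    case False
    then show ?thesis
      using component_eqD [OF Nil(1), of "[]"] component_eqD [OF Nil(2), of "[]"]
      by (auto simp: wedge_def)
  qed
next
  case (Cons x xs)
  \<comment> \<open>For \<open>p = 0\<close> the contraction is zero, so the truncated value of
    \<open>p - 1\<close> never enters; likewise for \<open>q\<close> below.\<close>
  have 1: "shuf (ins x f) g xs = (if p = 0 then 0 else wedge (p - 1) q (ins x f) g xs)"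
  proof (cases "p = 0")
    case True
    show ?thesis by (simp add: True component_ins(1) [OF Cons.prems(1) True])
  next
    case False
    then show ?thesis using Cons.IH [OF component_ins(2) [OF Cons.prems(1)] Cons.prems(2)] by simp
  qed
  have 2: "shuf (grade_sign f) (ins x g) xs =
      (if q = 0 then 0 else (- 1) ^ p * wedge p (q - 1) f (ins x g) xs)"
  proof (cases "q = 0")
    case True
    show ?thesis by (simp add: True component_ins(1) [OF Cons.prems(2) True])
  next
    case False
    then show ?thesis
      using Cons.IH [OF Cons.prems(1) component_ins(2) [OF Cons.prems(2)]]
      by (simp add: grade_sign_component [OF Cons.prems(1)] smul_apply)
  qed
  show ?case
  proof (cases "p + q = Suc (length xs)")
    case True
    then show ?thesis by (simp only: shuf.simps wedge_Cons [OF True] 1 2)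
  next
    case False
    then show ?thesis by (auto simp: 1 2 wedge_def)
  qed
qed

lemma wedge_eq_0:
  assumes "component p f = f" "component q g = g" "p \<noteq> p' \<or> q \<noteq> q'"
  shows "wedge p' q' f g xs = 0"
  using component_eqD [OF assms(1)] component_eqD [OF assms(2)] assms(3)
  by (auto simp: wedge_def intro!: sum.neutral)

lemma alt_mult_eq_shuf:
  assumes "component p f = f" "component q g = g"
  shows "alt_mult f g = smul ((- 1) ^ (p * q)) (shuf f g)"
proof
  fix xs
  \<comment> \<open>Homogeneity leaves only the summand \<open>r = p\<close>, and that one only on
    lists of length \<open>p + q\<close>, where the exponent becomes \<open>p * q\<close>.\<close>
  have "alt_mult f g xs = (\<Sum>r\<le>length xs. if r = p then
      (- 1) ^ (p * (length xs - p)) * wedge p (length xs - p) f g xs else 0)"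
    unfolding alt_mult_def using wedge_eq_0 [OF assms] by (intro sum.cong) auto
  also have "\<dots> = (if length xs = p + q then (- 1) ^ (p * q) * wedge p q f g xs else 0)"
    using wedge_eq_0 [OF assms] by auto
  also have "\<dots> = smul ((- 1) ^ (p * q)) (shuf f g) xs"
    by (simp add: smul_apply shuf_eq_wedge [OF assms] wedge_def)
  finally show "alt_mult f g xs = smul ((- 1) ^ (p * q)) (shuf f g) xs" .
qed

subsection \<open>Alternating forms and the Cartan-Chevalley-Eilenberg operator\<close>

context unital_module
begin

lemma alternating_swap_nth:
  "alternating f \<Longrightarrow> f (us @ x # y # vs) = - f (us @ y # x # vs)"
proof (induction us arbitrary: f)
  case Nil
  from fun_cong [OF alternating_swap [OF this, of y x], of vs] show ?case
    by (simp add: ins_apply)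
next
  case (Cons u us)
  from Cons.IH [OF alternating_ins, OF Cons.prems, of u] show ?case by (simp add: ins_apply)
qed

text \<open>Adjacent swaps carry the first occurrence of \<open>x\<close> through \<open>vs\<close>
  until the two occurrences are neighbours.\<close>

lemma alternating_repeat:
  assumes "alternating f"
  shows "f (us @ x # vs @ x # ws) = 0"
proof (induction vs arbitrary: us)
  case Nil
  show ?case using assms by (simp add: alternating_def)
next
  case (Cons v vs)
  have "f (us @ x # v # vs @ x # ws) = - f ((us @ [v]) @ x # vs @ x # ws)"
    using alternating_swap_nth [OF assms, of us x v "vs @ x # ws"] by simp
  then show ?case by (simp only: Cons append_Cons neg_equal_0_iff_equal)
qed

text \<open>Positions \<open>i\<close> in a list of length \<open>m\<close> correspond to
  decompositions \<open>us @ x # vs\<close>; on lists of other lengths every term is zero. The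
  passage from adjacent to arbitrary repetitions is \<open>alternating_repeat\<close>.\<close>

lemma alt_forms_iff: "f \<in> alt_forms scale m \<longleftrightarrow> alternating f \<and> component m f = f"
proof
  assume f: "f \<in> alt_forms scale m"
  then have 0: "f xs = 0" if "length xs \<noteq> m" for xs using that by (simp add: alt_forms_def)
  have "alternating f"
    unfolding alternating_def
  proof (intro conjI allI)
    fix us vs :: "'l list" and x y a
    show "f (us @ (x + y) # vs) = f (us @ x # vs) + f (us @ y # vs)"
    proof (cases "length us + Suc (length vs) = m")
      case True
      then have "f ((us @ x # vs)[length us := x + y]) =
          f ((us @ x # vs)[length us := x]) + f ((us @ x # vs)[length us := y])"
        using f by (auto simp: alt_forms_def simp del: list_update_length)
      then show ?thesis by simp
    qed (simp add: 0)
    show "f (us @ scale a x # vs) = a * f (us @ x # vs)"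
    proof (cases "length us + Suc (length vs) = m")
      case True
      then have "f ((us @ x # vs)[length us := scale a x]) = a * f ((us @ x # vs)[length us := x])"
        using f by (auto simp: alt_forms_def simp del: list_update_length)
      then show ?thesis by simp
    qed (simp add: 0)
    show "f (us @ x # x # vs) = 0"
    proof (cases "length us + Suc (Suc (length vs)) = m")
      case True
      have "length us < Suc (length us)" "Suc (length us) < m"
        "(us @ x # x # vs) ! length us = (us @ x # x # vs) ! Suc (length us)"
        using True by (simp_all add: nth_append)
      moreover have "length (us @ x # x # vs) = m" using True by simp
      ultimately show ?thesis using f unfolding alt_forms_def by blast
    qed (simp add: 0)
  qed
  moreover have "component m f = f" using 0 by (auto simp: component_apply)
  ultimately show "alternating f \<and> component m f = f" ..
next
  assume f: "alternating f \<and> component m f = f"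
  then have lin: "\<And>us x y vs. f (us @ (x + y) # vs) = f (us @ x # vs) + f (us @ y # vs)"
    "\<And>us a x vs. f (us @ scale a x # vs) = a * f (us @ x # vs)"
    by (simp_all add: alternating_def)
  have "f xs = 0" if "i < j" "j < length xs" "xs ! i = xs ! j" for xs i j
  proof -
    \<comment> \<open>Cut the list at positions \<open>i\<close> and \<open>j\<close>;
      \<open>j\<close> has index \<open>j - Suc i\<close> in the part after
      \<open>i\<close>.\<close>
    let ?ys = "drop (Suc i) xs"
    let ?vs = "take (j - Suc i) ?ys"
    have "xs = take i xs @ xs ! i # ?ys"
      using that by (intro id_take_nth_drop) simp
    moreover have "?ys = ?vs @ ?ys ! (j - Suc i) # drop (Suc (j - Suc i)) ?ys"
      using that by (intro id_take_nth_drop) simp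
    moreover have "?ys ! (j - Suc i) = xs ! j"
      using that by simp
    ultimately have "xs = take i xs @ xs ! i # ?vs @ xs ! i # drop (Suc (j - Suc i)) ?ys"
      using that(3) by (simp only:)
    then show ?thesis using alternating_repeat f by metis
  qed
  then show "f \<in> alt_forms scale m"
    using f component_eqD [of m f]
    by (auto simp: alt_forms_def upd_conv_take_nth_drop lin)
qed

lemma alternating_component: "alternating f \<Longrightarrow> alternating (component m f)"
  by (simp add: alternating_def component_apply)

lemma component_component [simp]: "component m (component m f) = component m f"
  by (simp add: fun_eq_iff component_apply)

text \<open>Each defining condition only relates values on lists of one common length, hence
  involves a single component.\<close>

lemma alternating_iff_component: "alternating f \<longleftrightarrow> (\<forall>m. alternating (component m f))"
proof
  assume *: "\<forall>m. alternating (component m f)"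
  have eq: "f xs = component (length xs) f xs" for xs
    by (simp add: component_apply)
  show "alternating f"
    unfolding alternating_def
  proof (intro conjI allI)
    fix us vs :: "'l list" and x y a
    let ?n = "Suc (length us + length vs)"
    have "component ?n f (us @ (x + y) # vs) = component ?n f (us @ x # vs) + component ?n f (us @ y # vs)"
      "component ?n f (us @ scale a x # vs) = a * component ?n f (us @ x # vs)"
      "component (Suc ?n) f (us @ x # x # vs) = 0"
      using * unfolding alternating_def by blast+
    then show "f (us @ (x + y) # vs) = f (us @ x # vs) + f (us @ y # vs)"
      "f (us @ scale a x # vs) = a * f (us @ x # vs)" "f (us @ x # x # vs) = 0"
      by (simp_all add: component_apply)
  qed
qed (simp add: alternating_component)

lemma Alt_iff: "f \<in> Alt scale \<longleftrightarrow> alternating f \<and> finite {m. component m f \<noteq> 0}"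
  unfolding Alt_def zero_fun_def [symmetric]
  by (simp add: alt_forms_iff alternating_iff_component [of f])

lemma component_simps [simp]:
  "component m (f + g) = component m f + component m g"
  "component m (- f) = - component m f"
  "component m (f - g) = component m f - component m g"
  "component m 0 = 0"
  "component m (smul a f) = smul a (component m f)"
  "component m (grade_sign f) = grade_sign (component m f)"
  by (auto simp: fun_eq_iff component_apply smul_apply grade_sign_apply)

lemma component_other:
  assumes "component m f = f" "k \<noteq> m"
  shows "component k f = 0"
  using component_eqD [OF assms(1)] assms(2) by (auto simp: fun_eq_iff component_apply)

lemma alt_forms_subset_Alt: "f \<in> alt_forms scale m \<Longrightarrow> f \<in> Alt scale"
proof -
  assume f: "f \<in> alt_forms scale m"
  then have "{k. component k f \<noteq> 0} \<subseteq> {m}"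
    using component_other by (auto simp: alt_forms_iff)
  then show ?thesis using f finite_subset by (auto simp: alt_forms_iff Alt_iff)
qed

lemma Alt_add: "f \<in> Alt scale \<Longrightarrow> g \<in> Alt scale \<Longrightarrow> f + g \<in> Alt scale"
proof -
  assume fg: "f \<in> Alt scale" "g \<in> Alt scale"
  have "{m. component m (f + g) \<noteq> 0} \<subseteq> {m. component m f \<noteq> 0} \<union> {m. component m g \<noteq> 0}"
    by auto
  then show ?thesis
    using fg finite_subset by (auto simp: Alt_iff alternating_add)
qed

lemma Alt_smul: "f \<in> Alt scale \<Longrightarrow> smul a f \<in> Alt scale"
proof -
  assume f: "f \<in> Alt scale"
  have "{m. component m (smul a f) \<noteq> 0} \<subseteq> {m. component m f \<noteq> 0}"
    by auto
  then show ?thesis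
    using f finite_subset by (auto simp: Alt_iff alternating_smul)
qed

lemma component_shuf:
  assumes "component p f = f" "component q g = g"
  shows "component (p + q) (shuf f g) = shuf f g"
  by (auto simp: fun_eq_iff component_apply shuf_eq_wedge [OF assms] wedge_def)

lemma alt_mult_alt_forms:
  assumes "f \<in> alt_forms scale p" "g \<in> alt_forms scale q"
  shows "alt_mult f g \<in> alt_forms scale (p + q)"
proof -
  have "alternating f" "alternating g" "component p f = f" "component q g = g"
    using assms by (simp_all add: alt_forms_iff)
  then show ?thesis
    by (simp add: alt_forms_iff alt_mult_eq_shuf [of p f q g] alternating_smul alternating_shuf
        component_shuf)
qed

end

section \<open>The explicit Cartan-Chevalley-Eilenberg sum\<close>

lemma nths_Cons_Compl [simp]:
  "nths (y # ys) (- {0}) = ys"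
  "nths (y # ys) (- {Suc k}) = y # nths ys (- {k})"
  "nths (y # ys) (- {0, Suc k}) = nths ys (- {k})"
  "nths (y # ys) (- {Suc j, Suc k}) = y # nths ys (- {j, k})"
proof -
  have "{j. Suc j \<in> - {0}} = UNIV" "{j. Suc j \<in> - {Suc k}} = - {k}"
    "{j. Suc j \<in> - {0, Suc k}} = - {k}" "{i. Suc i \<in> - {Suc j, Suc k}} = - {j, k}"
    by auto
  then show "nths (y # ys) (- {0}) = ys"
    "nths (y # ys) (- {Suc k}) = y # nths ys (- {k})"
    "nths (y # ys) (- {0, Suc k}) = nths ys (- {k})"
    "nths (y # ys) (- {Suc j, Suc k}) = y # nths ys (- {j, k})"
    by (simp_all only: nths_Cons) (simp_all add: nths_all)
qed

lemma minus_one_power_Suc_mult: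
  fixes a :: "'a::{comm_ring, comm_monoid_mult}"
  shows "(- 1) ^ Suc n * a = - ((- 1) ^ n * a)"
  by (simp add: minus_one_power_mult del: power_Suc)

context pre_lie_rinehart
begin

text \<open>The bracket \<open>br x (xs ! k)\<close> replaces the argument at position
  \<open>k\<close>; moving it past \<open>k\<close> arguments to the front gives the sign.\<close>

lemma lder_eq_sum:
  assumes "alternating f"
  shows "lder x f xs = anchor x (f xs) -
    (\<Sum>k<length xs. (- 1) ^ k * f (br x (xs ! k) # nths xs (- {k})))"
  using assms
proof (induction xs arbitrary: f)
  case (Cons y ys)
  have "f (br x z # y # zs) = - ins y f (br x z # zs)" for z zs
    using alternating_swap_nth [OF Cons.prems, of "[]" "br x z" y zs] by (simp add: ins_apply)
  then show ?case
    by (simp add: Cons.IH [OF alternating_ins, OF Cons.prems] sum.lessThan_Suc_shift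
        minus_one_power_Suc_mult sum_negf ins_apply del: sum.lessThan_Suc power_Suc)
qed simp

definition cce_sum :: "('l list \<Rightarrow> 'a) \<Rightarrow> 'l list \<Rightarrow> 'a" where
  "cce_sum f xs = (\<Sum>i<length xs. (- 1) ^ i * anchor (xs ! i) (f (nths xs (- {i})))) +
     (\<Sum>k<length xs. \<Sum>j<k. (- 1) ^ (j + k) * f (br (xs ! j) (xs ! k) # nths xs (- {j, k})))"

text \<open>Cartan's formula for the explicit sum. The terms with \<open>i = 0\<close> or
  \<open>j = 0\<close> assemble to the Lie derivative by \<open>lder_eq_sum\<close>; in the others
  the index shift, or the swap of the bracket with \<open>x\<close>, accounts for the minus
  sign.\<close>

lemma cce_sum_Cons:
  assumes "alternating f"
  shows "cce_sum f (x # xs) = lder x f xs - cce_sum (ins x f) xs"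
proof -
  have 1: "f (br y z # x # zs) = - ins x f (br y z # zs)" for y z zs
    using alternating_swap_nth [OF assms, of "[]" "br y z" x zs] by (simp add: ins_apply)
  have 2: "(- 1) ^ (Suc j + Suc k) * a = (- 1) ^ (j + k) * a" for j k and a :: 'a
    by (simp add: minus_one_power_mult del: power_Suc)
  show ?thesis
    unfolding cce_sum_def lder_eq_sum [OF assms] length_Cons sum.lessThan_Suc_shift 2
      nth_Cons_0 nth_Cons_Suc nths_Cons_Compl
    by (simp add: 1 minus_one_power_Suc_mult sum_negf sum_subtractf ins_apply sum.distrib
        del: sum.lessThan_Suc power_Suc)
qed

lemma cder_eq_cce_sum: "alternating f \<Longrightarrow> cder f xs = cce_sum f xs"
proof (induction xs arbitrary: f)
  case Nil
  show ?case by (simp add: cce_sum_def)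
next
  case (Cons x xs)
  then show ?case by (simp add: cce_sum_Cons alternating_ins)
qed

lemma cce_eq: "f \<in> Alt scale \<Longrightarrow> cce scale br anchor f = grade_sign (cder f)"
  by (auto simp: cce_def fun_eq_iff grade_sign_def Alt_iff cder_eq_cce_sum cce_sum_def)

lemma component_lder: "component m (lder x f) = lder x (component m f)"
proof
  fix xs
  show "component m (lder x f) xs = lder x (component m f) xs"
  proof (induction xs arbitrary: m f)
    case Nil
    show ?case by (simp add: component_apply)
  next
    case (Cons y ys)
    have "ins y (component m (lder x f)) ys = ins y (lder x (component m f)) ys"
      by (cases m) (simp_all add: Cons)
    then show ?case by (rule Cons_eqI)
  qed
qed

lemma component_cder: "component 0 (cder f) = 0" "component (Suc m) (cder f) = cder (component m f)"
proof -
  show "component 0 (cder f) = 0"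
    by (simp add: fun_eq_iff component_apply)
  show "component (Suc m) (cder f) = cder (component m f)"
  proof
    fix xs
    show "component (Suc m) (cder f) xs = cder (component m f) xs"
    proof (induction xs arbitrary: m f)
      case Nil
      show ?case by (simp add: component_apply)
    next
      case (Cons y ys)
      have "component 0 (cder g) = 0" for g :: "'l list \<Rightarrow> 'a"
        by (simp add: fun_eq_iff component_apply)
      then have "ins y (component (Suc m) (cder f)) ys = ins y (cder (component m f)) ys"
        by (cases m) (simp_all add: Cons component_lder)
      then show ?case by (rule Cons_eqI)
    qed
  qed
qed

lemma cder_alt_forms: "f \<in> alt_forms scale m \<Longrightarrow> cder f \<in> alt_forms scale (Suc m)"
  by (simp add: alt_forms_iff alternating_cder component_cder)

lemma grade_sign_alt_forms: "f \<in> alt_forms scale m \<Longrightarrow> grade_sign f \<in> alt_forms scale m"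
  by (simp add: alt_forms_iff alternating_grade_sign)

lemma grade_sign_cder_Alt:
  assumes "f \<in> Alt scale"
  shows "grade_sign (cder f) \<in> Alt scale"
proof -
  have "{m. component m (grade_sign (cder f)) \<noteq> 0} \<subseteq> Suc ` {m. component m f \<noteq> 0}"
  proof
    fix k assume "k \<in> {m. component m (grade_sign (cder f)) \<noteq> 0}"
    then show "k \<in> Suc ` {m. component m f \<noteq> 0}"
      by (cases k) (auto simp: component_cder)
  qed
  then show ?thesis
    using assms finite_subset by (auto simp: Alt_iff alternating_cder alternating_grade_sign)
qed

text \<open>Raising \<open>p\<close> by one changes the Koszul sign \<open>(-1)^(p*q)\<close> by
  \<open>(-1)^q\<close>, raising \<open>q\<close> changes it by \<open>(-1)^p\<close>. The outer
  \<open>grade_sign\<close> absorbs both changes, so the antiderivation rule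
  \<open>cder_shuf\<close> becomes the graded derivation rule for \<open>alt_mult\<close>.\<close>

lemma cce_alt_mult:
  assumes f: "f \<in> alt_forms scale p" and g: "g \<in> alt_forms scale q"
  shows "cce scale br anchor (alt_mult f g) =
    alt_mult (cce scale br anchor f) g + smul ((- 1) ^ p) (alt_mult f (cce scale br anchor g))"
proof -
  have comp: "component p f = f" "component q g = g"
    using f g by (simp_all add: alt_forms_iff)
  have comp': "component (Suc p) (cder f) = cder f" "component (Suc q) (cder g) = cder g"
    using comp by (simp_all add: component_cder)
  have comp'': "component (Suc p) (grade_sign (cder f)) = grade_sign (cder f)"
    "component (Suc q) (grade_sign (cder g)) = grade_sign (cder g)"
    using comp' by simp_all
  have cce: "cce scale br anchor f = grade_sign (cder f)" "cce scale br anchor g = grade_sign (cder g)"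
    "cce scale br anchor (alt_mult f g) = grade_sign (cder (alt_mult f g))"
    using f g alt_mult_alt_forms [OF f g] by (auto intro!: cce_eq alt_forms_subset_Alt)
  show ?thesis
    unfolding cce
    unfolding alt_mult_eq_shuf [OF comp] alt_mult_eq_shuf [OF comp''(1) comp(2)]
      alt_mult_eq_shuf [OF comp(1) comp''(2)]
    by (auto simp: smul_minus_one_power grade_sign_component [OF comp'(1)]
        grade_sign_component [OF comp'(2)] grade_sign_component [OF comp(1)]
        grade_sign_component [OF comp(2)])
qed

end

subsection \<open>Generation in degrees 0 and 1\<close>

definition one_form :: "('l \<Rightarrow> 'a::zero) \<Rightarrow> 'l list \<Rightarrow> 'a" where
  "one_form \<phi> xs = (case xs of [x] \<Rightarrow> \<phi> x | _ \<Rightarrow> 0)"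

lemma one_form_simps [simp]:
  "one_form \<phi> [] = 0" "one_form \<phi> [x] = \<phi> x" "one_form \<phi> (x # y # xs) = 0"
  by (simp_all add: one_form_def)

lemma ins_one_form [simp]: "ins x (one_form \<phi>) = const_form (\<phi> x)"
proof
  fix xs show "ins x (one_form \<phi>) xs = const_form (\<phi> x) xs"
    by (cases xs) (simp_all add: ins_apply)
qed

lemma component_one_form [simp]: "component (Suc 0) (one_form \<phi>) = one_form \<phi>"
  by (auto simp: fun_eq_iff component_apply one_form_def split: list.split)

lemma component_const_form [simp]: "component 0 (const_form a) = const_form a"
  by (auto simp: fun_eq_iff component_apply const_form_def)

lemma grade_sign_one_form [simp]: "grade_sign (one_form \<phi>) = - one_form \<phi>"
  using grade_sign_component [OF component_one_form, of \<phi>] smul_minus_one_power [of 1 "one_form \<phi>"]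
  by simp

lemma zero_formE:
  assumes "component 0 f = f"
  shows "f = const_form (f [])"
  using component_eqD [OF assms] by (auto simp: fun_eq_iff const_form_def)

section \<open>Pullbacks and finite dual bases\<close>

definition pullback :: "('l \<Rightarrow> 'm) \<Rightarrow> ('m list \<Rightarrow> 'a) \<Rightarrow> 'l list \<Rightarrow> 'a" where
  "pullback P f = (\<lambda>xs. f (map P xs))"

lemma ins_pullback [simp]: "ins x (pullback P f) = pullback P (ins (P x) f)"
  by (simp add: pullback_def ins_def)

lemma pullback_simps [simp]:
  "pullback P (f + g) = pullback P f + pullback P g"
  "pullback P (- f) = - pullback P f"
  "pullback P 0 = 0"
  "pullback P (smul a f) = smul a (pullback P f)"
  by (simp_all add: pullback_def smul_def fun_eq_iff)

lemma component_pullback: "component m (pullback P f) = pullback P (component m f)"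
  by (simp add: pullback_def component_def)

context unital_module
begin

lemma alternating_pullback:
  assumes "alternating f" "linear_map scale scale P"
  shows "alternating (pullback P f)"
  using assms by (simp add: alternating_def pullback_def linear_map_def)

lemma alternating_one_form:
  assumes "linear_map scale (*) \<phi>"
  shows "alternating (one_form \<phi>)"
proof -
  have "one_form \<phi> (us @ x # vs) = (if us = [] \<and> vs = [] then \<phi> x else 0)" for us x vs
    by (cases us; cases vs) (auto simp: one_form_def split: list.split)
  then show ?thesis
    using assms by (simp add: alternating_def linear_map_def)
qed

lemma const_form_alt_forms: "const_form a \<in> alt_forms scale 0"
  by (simp add: alt_forms_iff alternating_const_form)

lemma one_form_alt_forms: "linear_map scale (*) \<phi> \<Longrightarrow> one_form \<phi> \<in> alt_forms scale (Suc 0)"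
  by (simp add: alt_forms_iff alternating_one_form)

text \<open>A term in which \<open>e\<close> is inserted twice vanishes by alternation, so the
  multilinear expansion stops at first order in \<open>\<phi>\<close>. This is what avoids division
  by factorials.\<close>

lemma pullback_add_rank_one:
  assumes "alternating f"
  shows "pullback (\<lambda>x. scale (\<phi> x) e + P x) f =
    shuf (one_form \<phi>) (pullback P (ins e f)) + pullback P f"
proof
  fix xs
  show "pullback (\<lambda>x. scale (\<phi> x) e + P x) f xs =
    (shuf (one_form \<phi>) (pullback P (ins e f)) + pullback P f) xs"
    using assms
  proof (induction xs arbitrary: f)
    case Nil
    show ?case by (simp add: pullback_def)
  next
    case (Cons x xs)
    \<comment> \<open>The induction hypothesis for \<open>ins (P x) f\<close> inserts
      \<open>e\<close> after \<open>P x\<close>, the contraction of the right-hand side in the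
      opposite order.\<close>
    have "shuf (one_form \<phi>) (pullback P (ins e (ins (P x) f))) =
        - shuf (one_form \<phi>) (pullback P (ins (P x) (ins e f)))"
      by (simp only: alternating_swap [OF Cons.prems, of e "P x"] pullback_simps shuf_simps)
    moreover have "shuf (one_form \<phi>) (pullback P (ins e (ins e f))) = 0"
      by (simp only: alternating_head [OF Cons.prems] pullback_simps shuf_simps)
    ultimately have "ins x (pullback (\<lambda>x. scale (\<phi> x) e + P x) f) xs =
        ins x (shuf (one_form \<phi>) (pullback P (ins e f)) + pullback P f) xs"
      by (simp add: alternating_head(1,2) [OF Cons.prems] Cons.IH [OF alternating_ins, OF Cons.prems]
          smul_apply)
    then show ?case by (rule Cons_eqI)
  qed
qed

lemma linear_map_sum_scale:
  assumes "finite T" "\<And>t. t \<in> T \<Longrightarrow> linear_map scale (*) (\<phi> t)"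
  shows "linear_map scale scale (\<lambda>x. \<Sum>t\<in>T. scale (\<phi> t x) (e t))"
proof -
  have 0: "scale a 0 = 0" for a
    using scale_add_right [of a 0 0] by simp
  show ?thesis
    using assms
  proof (induction T)
    case empty
    show ?case by (simp add: linear_map_def 0)
  next
    case (insert t T)
    have "linear_map scale (*) (\<phi> t)" using insert by simp
    with insert show ?case
      by (simp add: linear_map_def scale_add_left scale_add_right scale_scale algebra_simps)
  qed
qed

end

text \<open>The form in which finite generation and projectivity are used. The \<open>e t\<close>
  are generators, not necessarily independent.\<close>

locale dual_basis = unital_module scale
  for scale :: "'a::{comm_ring, comm_monoid_mult} \<Rightarrow> 'l::ab_group_add \<Rightarrow> 'l" +
  fixes T :: "'i set" and \<phi> :: "'i \<Rightarrow> 'l \<Rightarrow> 'a" and e :: "'i \<Rightarrow> 'l"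
  assumes finite_basis: "finite T"
    and linear_coord: "linear_map scale (*) (\<phi> t)"
    and basis_expand: "x = (\<Sum>t\<in>T. scale (\<phi> t x) (e t))"
begin

text \<open>Induction over partial sums of the identity of the module: the empty sum pulls
  \<open>f\<close> back to zero because \<open>f\<close> has at least one variable, each further
  basis index adds one product by \<open>pullback_add_rank_one\<close>, and the sum over
  \<open>T\<close> gives \<open>f\<close> itself.\<close>

lemma alt_forms_induct:
  assumes f: "f \<in> alt_forms scale (Suc m)"
    and zero: "Q 0"
    and add: "\<And>f g. Q f \<Longrightarrow> Q g \<Longrightarrow> Q (f + g)"
    and shuf: "\<And>t g. g \<in> alt_forms scale m \<Longrightarrow> Q (shuf (one_form (\<phi> t)) g)"
  shows "Q f"
proof -
  have alt: "alternating f" and comp: "component (Suc m) f = f"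
    using f by (simp_all add: alt_forms_iff)
  have "Q (pullback (\<lambda>x. \<Sum>t\<in>S. scale (\<phi> t x) (e t)) f)" if "finite S" for S
    using that
  proof (induction S)
    case empty
    have "pullback (\<lambda>x::'l. 0) f = 0"
    proof
      fix xs
      show "pullback (\<lambda>x::'l. 0) f xs = 0 xs"
      proof (cases xs)
        case Nil
        then show ?thesis using component_eqD [OF comp, of "[]"] by (simp add: pullback_def)
      next
        case (Cons y ys)
        then show ?thesis
          using fun_cong [OF alternating_ins_zero [OF alt], of "map (\<lambda>x. 0) ys"]
          by (simp add: pullback_def ins_apply)
      qed
    qed
    with zero show ?case by (simp only: sum.empty)
  next
    case (insert t S)
    let ?P = "\<lambda>x. \<Sum>t\<in>S. scale (\<phi> t x) (e t)"
    have "pullback ?P (ins (e t) f) \<in> alt_forms scale m"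
      using alternating_pullback [OF alternating_ins [OF alt] linear_map_sum_scale [OF insert(1)]]
        linear_coord component_ins(2) [OF comp, of "e t"]
      by (simp add: alt_forms_iff component_pullback)
    then show ?case
      using insert by (simp add: pullback_add_rank_one [OF alt] add shuf del: plus_fun_apply)
  qed
  from this [OF finite_basis] show ?thesis
    unfolding basis_expand [symmetric] by (simp add: pullback_def)
qed

text \<open>The coordinates \<open>\<phi> t\<close> determine an element, so identities in the
  module can be tested under linear forms.\<close>

lemma eq_if_linear_maps_eq:
  assumes "\<And>\<psi>. linear_map scale (*) \<psi> \<Longrightarrow> \<psi> x = \<psi> y"
  shows "x = y"
  using basis_expand [of x] basis_expand [of y] assms [OF linear_coord] by simp

end

lemma finite_projective_dual_basis:
  fixes scale :: "'a::{comm_ring, comm_monoid_mult} \<Rightarrow> 'l::ab_group_add \<Rightarrow> 'l"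
  assumes "unital_module scale" "finitely_generated scale" "projective scale"
  obtains T :: "'l set" and \<phi> e where "dual_basis scale T \<phi> e"
proof -
  interpret unital_module scale by fact
  obtain S where S: "finite S" "\<And>x. \<exists>c. x = (\<Sum>s\<in>S. scale (c s) s)"
    using assms(2) by (auto simp: finitely_generated_def)
  obtain \<iota> :: "'l \<Rightarrow> ('l \<Rightarrow>\<^sub>0 'a)" and \<pi> where \<iota>: "linear_map scale free_scale \<iota>"
    and \<pi>: "linear_map free_scale scale \<pi>" and \<pi>\<iota>: "\<And>x. \<pi> (\<iota> x) = x"
    using assms(3) by (auto simp: projective_def)
  \<comment> \<open>\<open>T\<close> collects the finitely many free coordinates met by the section
    \<open>\<iota>\<close> on the generators; \<open>e t\<close> is the image under
    \<open>\<pi>\<close> of a free basis vector.\<close>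
  define T where "T = (\<Union>s\<in>S. Poly_Mapping.keys (\<iota> s))"
  define \<phi> where "\<phi> t x = Poly_Mapping.lookup (\<iota> x) t" for t x
  define e where "e t = \<pi> (Poly_Mapping.single t 1)" for t
  have lookup_free_scale: "Poly_Mapping.lookup (free_scale a v) t = a * Poly_Mapping.lookup v t"
    for a t and v :: "'l \<Rightarrow>\<^sub>0 'a"
    by (simp add: free_scale_def Poly_Mapping.map.rep_eq when_def)
  have lin: "linear_map scale (*) (\<phi> t)" for t
    using \<iota> by (simp add: linear_map_def \<phi>_def lookup_add lookup_free_scale)
  have lin_sum: "h (\<Sum>i\<in>I. f i) = (\<Sum>i\<in>I. h (f i))"
    if "finite I" "\<And>x y. h (x + y) = h x + h y" for h :: "'x::ab_group_add \<Rightarrow> 'y::ab_group_add"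
      and f and I :: "'l set"
  proof -
    have "h 0 = 0" using that(2) [of 0 0] by simp
    with that show ?thesis by (induction I) simp_all
  qed
  \<comment> \<open>Coordinates outside \<open>T\<close> vanish on the generators, hence everywhere
    by linearity. So \<open>\<iota> x\<close> is a sum over \<open>T\<close>, and applying
    \<open>\<pi>\<close> gives the expansion of \<open>x\<close>.\<close>
  have supp: "\<phi> t x = 0" if "t \<notin> T" for t x
  proof -
    obtain c where c: "x = (\<Sum>s\<in>S. scale (c s) s)" using S(2) by blast
    have "\<phi> t x = (\<Sum>s\<in>S. \<phi> t (scale (c s) s))"
      unfolding c using lin [of t] S(1) by (intro lin_sum) (auto simp: linear_map_def)
    also have "\<dots> = (\<Sum>s\<in>S. c s * \<phi> t s)"
      using lin [of t] by (simp add: linear_map_def)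
    also have "\<dots> = 0"
      using that by (intro sum.neutral) (auto simp: T_def \<phi>_def in_keys_iff)
    finally show ?thesis .
  qed
  have fin: "finite T" using S(1) by (simp add: T_def)
  have expand: "x = (\<Sum>t\<in>T. scale (\<phi> t x) (e t))" for x
  proof -
    have "\<iota> x = (\<Sum>t\<in>T. free_scale (\<phi> t x) (Poly_Mapping.single t 1))"
    proof (rule poly_mapping_eqI)
      fix k
      have "Poly_Mapping.lookup (\<Sum>t\<in>T. free_scale (\<phi> t x) (Poly_Mapping.single t 1)) k =
          (\<Sum>t\<in>T. Poly_Mapping.lookup (free_scale (\<phi> t x) (Poly_Mapping.single t 1)) k)"
        using fin by (rule lin_sum) (simp add: lookup_add)
      also have "\<dots> = (\<Sum>t\<in>T. if t = k then \<phi> k x else 0)"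
        by (intro sum.cong) (auto simp: lookup_free_scale lookup_single when_def)
      also have "\<dots> = Poly_Mapping.lookup (\<iota> x) k"
        using fin supp [of k x] by (auto simp: \<phi>_def)
      finally show "Poly_Mapping.lookup (\<iota> x) k =
          Poly_Mapping.lookup (\<Sum>t\<in>T. free_scale (\<phi> t x) (Poly_Mapping.single t 1)) k" ..
    qed
    then have "x = \<pi> (\<Sum>t\<in>T. free_scale (\<phi> t x) (Poly_Mapping.single t 1))"
      using \<pi>\<iota> by metis
    also have "\<dots> = (\<Sum>t\<in>T. \<pi> (free_scale (\<phi> t x) (Poly_Mapping.single t 1)))"
      using \<pi> fin by (intro lin_sum) (auto simp: linear_map_def)
    finally show ?thesis
      using \<pi> by (simp add: linear_map_def e_def)
  qed
  have "dual_basis scale T \<phi> e"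
    by unfold_locales (fact fin lin expand)+
  then show thesis by (rule that)
qed

section \<open>Graded derivations of the algebra of forms\<close>

context unital_module
begin

text \<open>The additive, degree and product conditions on a Maurer-Cartan operator. They already
  determine the operator on \<open>Alt\<close> by its values in degrees 0 and 1 and yield a bracket
  and an anchor; scalars from the ground ring and \<open>dd = 0\<close> are treated
  separately.\<close>

definition graded_derivation :: "(('l list \<Rightarrow> 'a) \<Rightarrow> ('l list \<Rightarrow> 'a)) \<Rightarrow> bool" where
  "graded_derivation d \<longleftrightarrow>
     (\<forall>f\<in>Alt scale. \<forall>g\<in>Alt scale. d (f + g) = d f + d g) \<and>
     (\<forall>m. \<forall>f\<in>alt_forms scale m. d f \<in> alt_forms scale (Suc m)) \<and>
     (\<forall>p q. \<forall>f\<in>alt_forms scale p. \<forall>g\<in>alt_forms scale q.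
        d (alt_mult f g) = alt_mult (d f) g + smul ((- 1) ^ p) (alt_mult f (d g)))"

lemma graded_derivationD:
  assumes "graded_derivation d"
  shows "f \<in> Alt scale \<Longrightarrow> g \<in> Alt scale \<Longrightarrow> d (f + g) = d f + d g"
    and "f \<in> alt_forms scale m \<Longrightarrow> d f \<in> alt_forms scale (Suc m)"
    and "f \<in> alt_forms scale p \<Longrightarrow> g \<in> alt_forms scale q \<Longrightarrow>
       d (alt_mult f g) = alt_mult (d f) g + smul ((- 1) ^ p) (alt_mult f (d g))"
  using assms by (auto simp: graded_derivation_def)

lemma maurer_cartan_iff:
  "d \<in> maurer_cartan_structures \<eta> scale \<longleftrightarrow>
     d \<in> Alt scale \<rightarrow>\<^sub>E Alt scale \<and> graded_derivation d \<and>
     (\<forall>r. \<forall>f\<in>Alt scale. d (smul (\<eta> r) f) = smul (\<eta> r) (d f)) \<and>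
     (\<forall>f\<in>Alt scale. d (d f) = 0)"
  unfolding maurer_cartan_structures_def graded_derivation_def smul_def plus_fun_def zero_fun_def
  by blast

lemma zero_alt_forms: "0 \<in> alt_forms scale m"
  by (simp add: alt_forms_iff alternating_zero)

lemma add_alt_forms: "f \<in> alt_forms scale m \<Longrightarrow> g \<in> alt_forms scale m \<Longrightarrow> f + g \<in> alt_forms scale m"
  by (simp add: alt_forms_iff alternating_add)

lemma smul_alt_forms: "f \<in> alt_forms scale m \<Longrightarrow> smul a f \<in> alt_forms scale m"
  by (simp add: alt_forms_iff alternating_smul)

lemma graded_derivation_zero: "graded_derivation d \<Longrightarrow> d 0 = 0"
  using graded_derivationD(1) [of d 0 0] alt_forms_subset_Alt [OF zero_alt_forms] by simp

lemma Alt_induct: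
  assumes f: "f \<in> Alt scale"
    and zero: "Q 0"
    and add: "\<And>f g. f \<in> Alt scale \<Longrightarrow> g \<in> Alt scale \<Longrightarrow> Q f \<Longrightarrow> Q g \<Longrightarrow> Q (f + g)"
    and homogeneous: "\<And>m f. f \<in> alt_forms scale m \<Longrightarrow> Q f"
  shows "Q f"
proof -
  let ?S = "{m. component m f \<noteq> 0}"
  have fin: "finite ?S" using f by (simp add: Alt_iff)
  have comp: "component m f \<in> alt_forms scale m" for m
    using f by (simp add: Alt_iff alt_forms_iff alternating_component)
  have "(\<Sum>m\<in>S. component m f) \<in> Alt scale \<and> Q (\<Sum>m\<in>S. component m f)" if "finite S" for S
    using that
  proof (induction S)
    case empty
    show ?case using alt_forms_subset_Alt [OF zero_alt_forms] zero
      by (simp only: sum.empty simp_thms)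
  next
    case (insert m S)
    then show ?case
      using comp [of m]
      by (simp add: Alt_add add homogeneous alt_forms_subset_Alt del: plus_fun_apply)
  qed
  \<comment> \<open>At a list \<open>xs\<close> only the component of index \<open>length xs\<close>
    contributes; if that index is not in \<open>?S\<close>, then \<open>f xs\<close> is
    zero.\<close>
  moreover have "(\<Sum>m\<in>?S. component m f) = f"
  proof
    fix xs
    have "(\<Sum>m\<in>S. component m f) xs = (\<Sum>m\<in>S. if m = length xs then f xs else 0)" if "finite S" for S
      using that by (induction S) (simp_all add: component_apply)
    moreover have "f xs = 0" if "length xs \<notin> ?S"
    proof -
      have "component (length xs) f xs = 0 xs" using that by simp
      then show ?thesis by (simp add: component_apply)
    qed
    ultimately show "(\<Sum>m\<in>?S. component m f) xs = f xs"
      using fin by auto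
  qed
  ultimately show ?thesis using fin by metis
qed

end

context dual_basis
begin

text \<open>Additivity reduces to homogeneous forms, and \<open>alt_forms_induct\<close> writes
  these as sums of products of a coordinate form with a form of one variable fewer.\<close>

lemma graded_derivation_eqI:
  assumes d: "graded_derivation d" and d': "graded_derivation d'"
    and const: "\<And>a. d (const_form a) = d' (const_form a)"
    and one: "\<And>t. d (one_form (\<phi> t)) = d' (one_form (\<phi> t))"
    and f: "f \<in> Alt scale"
  shows "d f = d' f"
  using f
proof (rule Alt_induct)
  show "d 0 = d' 0" using d d' by (simp add: graded_derivation_zero)
next
  fix f g assume "f \<in> Alt scale" "g \<in> Alt scale" "d f = d' f" "d g = d' g"
  then show "d (f + g) = d' (f + g)"
    using d d' by (simp add: graded_derivationD(1))
next
  fix m f assume "f \<in> alt_forms scale m"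
  then show "d f = d' f"
  proof (induction m arbitrary: f)
    case 0
    then show ?case using const zero_formE by (metis alt_forms_iff)
  next
    case (Suc m)
    \<comment> \<open>Membership in \<open>Alt\<close> is carried through the induction because
      additivity of \<open>d\<close> and \<open>d'\<close> is available only there.\<close>
    have "f \<in> Alt scale \<and> d f = d' f"
      using Suc.prems
    proof (rule alt_forms_induct)
      show "0 \<in> Alt scale \<and> d 0 = d' 0"
        using d d' alt_forms_subset_Alt [OF zero_alt_forms] by (simp add: graded_derivation_zero)
    next
      fix f g assume "f \<in> Alt scale \<and> d f = d' f" "g \<in> Alt scale \<and> d g = d' g"
      then show "f + g \<in> Alt scale \<and> d (f + g) = d' (f + g)"
        using d d' by (simp add: graded_derivationD(1) Alt_add)
    next
      fix t g assume g: "g \<in> alt_forms scale m"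
      \<comment> \<open>A 1-form times a form of \<open>m\<close> variables carries the Koszul sign
        \<open>(-1)^m\<close>; twisting \<open>g\<close> by the same sign turns the shuffle product
        into an algebra product.\<close>
      let ?u = "one_form (\<phi> t)" and ?g = "smul ((- 1) ^ m) g"
      have u: "?u \<in> alt_forms scale (Suc 0)"
        by (rule one_form_alt_forms [OF linear_coord])
      have g': "?g \<in> alt_forms scale m" using g by (rule smul_alt_forms)
      have "alt_mult ?u ?g = smul ((- 1) ^ m) (shuf ?u ?g)"
        using alt_mult_eq_shuf [of "Suc 0" ?u m ?g] u g' by (simp add: alt_forms_iff)
      then have eq: "shuf ?u g = alt_mult ?u ?g"
        by (simp add: smul_minus_one_power)
      show "shuf ?u g \<in> Alt scale \<and> d (shuf ?u g) = d' (shuf ?u g)"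
        unfolding eq using alt_forms_subset_Alt [OF alt_mult_alt_forms [OF u g']]
        by (simp only: graded_derivationD(3) [OF d u g'] graded_derivationD(3) [OF d' u g']
            one Suc.IH [OF g'] simp_thms)
    qed
    then show ?case ..
  qed
qed

end

lemma const_form_zero: "const_form 0 xs = 0"
  by (simp add: const_form_def)

context pre_lie_rinehart
begin

lemma graded_derivation_cce: "graded_derivation (cce scale br anchor)"
  unfolding graded_derivation_def
  by (auto simp: cce_eq Alt_add cce_alt_mult alt_forms_subset_Alt grade_sign_alt_forms cder_alt_forms)

lemma cder_one_form_apply:
  "cder (one_form \<psi>) [x, y] = anchor x (\<psi> y) - anchor y (\<psi> x) - \<psi> (br x y)"
  by simp

lemma cder_const_form_apply: "cder (const_form a) [x] = anchor x a"
  by simp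

lemma cce_maurer_cartan:
  assumes "lie_rinehart" and lin: "\<And>x r a. anchor x (\<eta> r * a) = \<eta> r * anchor x a"
    and unit: "\<eta> 1 = 1"
  shows "cce scale br anchor \<in> maurer_cartan_structures \<eta> scale"
  unfolding maurer_cartan_iff
proof (intro conjI allI ballI graded_derivation_cce)
  show "cce scale br anchor \<in> Alt scale \<rightarrow>\<^sub>E Alt scale"
    using grade_sign_cder_Alt cce_eq by (auto simp: cce_def)
next
  fix r f assume f: "f \<in> Alt scale"
  \<comment> \<open>A derivation kills 1, hence also the image of \<open>\<eta>\<close>; so the
    product term in \<open>cder_smul\<close> disappears for scalars from the ground ring.\<close>
  have "anchor x (\<eta> r) = 0" for x
    using lin [of x r 1] anchor_mult [of x 1 1] by simp
  then have "cder (const_form (\<eta> r)) xs = 0" for xs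
  proof (induction xs)
    case (Cons x xs)
    then show ?case by (simp add: const_form_zero)
  qed simp
  then have "cder (const_form (\<eta> r)) = 0" by (simp add: fun_eq_iff)
  then show "cce scale br anchor (smul (\<eta> r) f) = smul (\<eta> r) (cce scale br anchor f)"
    using f by (simp add: cce_eq Alt_smul cder_smul)
next
  fix f assume f: "f \<in> Alt scale"
  then have "alternating f" by (simp add: Alt_iff)
  then show "cce scale br anchor (cce scale br anchor f) = 0"
    using f cder_cder [OF assms(1)] by (simp add: cce_eq grade_sign_cder_Alt)
qed

end

subsection \<open>The bijection\<close>

lemma lie_rinehart_structures_pre_lie_rinehart:
  assumes "unital_module scale" "(br, anchor) \<in> lie_rinehart_structures \<eta> scale"
  shows "pre_lie_rinehart scale br anchor" and "pre_lie_rinehart.lie_rinehart br anchor"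
    and "anchor x (\<eta> r * a) = \<eta> r * anchor x a"
proof -
  interpret unital_module scale by fact
  note * = assms(2) [unfolded lie_rinehart_structures_def is_lie_bracket_def
      is_lie_morphism_to_Der_def is_derivation_def mem_Collect_eq prod.case]
  show "anchor x (\<eta> r * a) = \<eta> r * anchor x a"
    using * [THEN conjunct2, THEN conjunct1, THEN conjunct1] by (elim allE conjE)
  show "pre_lie_rinehart scale br anchor"
    by unfold_locales (simp_all add: *)
  then interpret pre_lie_rinehart scale br anchor .
  show lie_rinehart
    unfolding lie_rinehart_def by (simp add: *)
qed

text \<open>Anchors annihilate the image of \<open>\<eta>\<close>, so the derivative terms in
  \<open>br_scale_left\<close> and \<open>br_scale_right\<close> vanish there. This turns the
  Leibniz rule into bilinearity of the bracket over the ground ring.\<close>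

lemma lie_rinehart_structuresI:
  assumes "pre_lie_rinehart scale br anchor" "pre_lie_rinehart.lie_rinehart br anchor"
    and lin: "\<And>x r a. anchor x (\<eta> r * a) = \<eta> r * anchor x a"
  shows "(br, anchor) \<in> lie_rinehart_structures \<eta> scale"
proof -
  interpret pre_lie_rinehart scale br anchor by fact
  have "anchor x 1 = 0" for x
    using anchor_mult [of x 1 1] by simp
  then have zero: "anchor x (\<eta> r) = 0" for x r
    using lin [of x r 1] by simp
  have "scale 0 x = 0" for x
    using scale_add_left [of 0 0 x] by simp
  then have "is_lie_bracket \<eta> scale br"
    using assms(2) unfolding is_lie_bracket_def lie_rinehart_def
    by (simp add: zero br_add_left br_add_right br_self br_scale_left br_scale_right)
  moreover have "is_lie_morphism_to_Der \<eta> scale br anchor"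
    using assms(2) unfolding is_lie_morphism_to_Der_def is_derivation_def lie_rinehart_def
    by (simp add: anchor_add anchor_mult anchor_add_left anchor_scale_left zero)
  ultimately show ?thesis
    by (simp add: lie_rinehart_structures_def anchor_scale_left br_scale_right)
qed

lemma component_eqI:
  assumes "component m f = f" "component m g = g" "\<And>xs. length xs = m \<Longrightarrow> f xs = g xs"
  shows "f = g"
proof
  fix xs show "f xs = g xs"
    using component_eqD [OF assms(1), of xs] component_eqD [OF assms(2), of xs] assms(3) [of xs]
    by (cases "length xs = m") simp_all
qed

context dual_basis
begin

text \<open>Values on forms of 0 variables recover the anchor; then values on 1-forms recover every
  \<open>\<psi> (br x y)\<close>, and linear forms separate elements.\<close>

lemma cce_inj:
  assumes "pre_lie_rinehart scale br anchor" "pre_lie_rinehart scale br' anchor'"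
    and eq: "cce scale br anchor = cce scale br' anchor'"
  shows "br = br'" and "anchor = anchor'"
proof -
  interpret L: pre_lie_rinehart scale br anchor by fact
  interpret L': pre_lie_rinehart scale br' anchor' by fact
  have cder_eq: "L.cder f = L'.cder f" if "f \<in> Alt scale" for f
  proof -
    have "grade_sign (L.cder f) = grade_sign (L'.cder f)"
      using fun_cong [OF eq, of f] by (simp only: L.cce_eq [OF that] L'.cce_eq [OF that])
    then have "grade_sign (grade_sign (L.cder f)) = grade_sign (grade_sign (L'.cder f))"
      by (rule arg_cong)
    then show ?thesis by (simp only: grade_sign_simps)
  qed
  show anchor: "anchor = anchor'"
  proof (intro ext)
    fix x a
    have "L.cder (const_form a) [x] = L'.cder (const_form a) [x]"
      using cder_eq [OF alt_forms_subset_Alt [OF const_form_alt_forms]] by (rule fun_cong)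
    then show "anchor x a = anchor' x a"
      by (simp only: L.cder_const_form_apply L'.cder_const_form_apply)
  qed
  show "br = br'"
  proof (intro ext eq_if_linear_maps_eq)
    fix x y \<psi> assume "linear_map scale (*) \<psi>"
    then have "L.cder (one_form \<psi>) [x, y] = L'.cder (one_form \<psi>) [x, y]"
      by (intro fun_cong [OF cder_eq] alt_forms_subset_Alt [OF one_form_alt_forms])
    then show "\<psi> (br x y) = \<psi> (br' x y)"
      unfolding L.cder_one_form_apply L'.cder_one_form_apply by (simp add: anchor)
  qed
qed

text \<open>The minus sign is the overall sign of \<open>cce\<close> on lists of length one.\<close>

definition anchor_of :: "(('l list \<Rightarrow> 'a) \<Rightarrow> 'l list \<Rightarrow> 'a) \<Rightarrow> 'l \<Rightarrow> 'a \<Rightarrow> 'a" where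
  "anchor_of d x a = - d (const_form a) [x]"

text \<open>The coordinates of the bracket are prescribed by solving the formula for the
  differential of \<open>\<phi> t\<close>; on two arguments the overall sign of \<open>cce\<close>
  is positive. \<open>bracket_of_form\<close> extends the prescription to all linear forms.\<close>

definition bracket_of :: "(('l list \<Rightarrow> 'a) \<Rightarrow> 'l list \<Rightarrow> 'a) \<Rightarrow> 'l \<Rightarrow> 'l \<Rightarrow> 'l" where
  "bracket_of d x y = (\<Sum>t\<in>T. scale (anchor_of d x (\<phi> t y) - anchor_of d y (\<phi> t x)
      - d (one_form (\<phi> t)) [x, y]) (e t))"

lemma shuf_one_form_apply: "shuf f (one_form \<psi>) [x, y] = f [x] * \<psi> y - f [y] * \<psi> x"
  by (simp add: ins_apply grade_sign_apply)

lemma linear_map_sum_scale_form: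
  assumes "linear_map scale (*) \<psi>" "finite S"
  shows "\<psi> (\<Sum>t\<in>S. scale (c t) (u t)) = (\<Sum>t\<in>S. c t * \<psi> (u t))"
  using assms(2)
proof (induction S)
  case empty
  have "\<psi> (0 + 0) = \<psi> 0 + \<psi> 0"
    using assms(1) unfolding linear_map_def by blast
  then show ?case by simp
next
  case (insert t S)
  then show ?case using assms(1) by (simp add: linear_map_def)
qed

lemma linear_form_expand:
  assumes "linear_map scale (*) \<psi>"
  shows "\<psi> x = (\<Sum>t\<in>T. \<phi> t x * \<psi> (e t))"
  using arg_cong [OF basis_expand [of x], of \<psi>]
  unfolding linear_map_sum_scale_form [OF assms finite_basis] .

section \<open>Reconstruction of bracket and anchor from a graded derivation\<close>

context
  fixes d assumes d: "graded_derivation d"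
begin

lemma anchor_of_add: "anchor_of d x (a + b) = anchor_of d x a + anchor_of d x b"
proof -
  have "(const_form (a + b) :: 'l list \<Rightarrow> 'a) = const_form a + const_form b"
    by (simp add: const_form_def fun_eq_iff)
  then have "d (const_form (a + b)) = d (const_form a) + d (const_form b)"
    by (simp only: graded_derivationD(1) [OF d]
        alt_forms_subset_Alt [OF const_form_alt_forms])
  then show ?thesis by (simp add: anchor_of_def)
qed

text \<open>The product rule with a form of 0 variables as left factor; the sign is the Koszul sign
  for 1 and \<open>m\<close> variables.\<close>

lemma derivation_const_form_mult:
  assumes "f \<in> alt_forms scale m"
  shows "d (smul a f) = smul ((- 1) ^ m) (shuf (d (const_form a)) f) + smul a (d f)"
proof -
  have eq: "alt_mult (const_form a) g = smul a g" if "g \<in> alt_forms scale k" for g k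
    using that alt_mult_eq_shuf [of 0 "const_form a" k g] by (simp add: alt_forms_iff)
  have "alt_mult (d (const_form a)) f = smul ((- 1) ^ m) (shuf (d (const_form a)) f)"
    using assms alt_mult_eq_shuf [of "Suc 0" "d (const_form a)" m f]
      graded_derivationD(2) [OF d const_form_alt_forms]
    by (simp add: alt_forms_iff)
  then show ?thesis
    using graded_derivationD(3) [OF d const_form_alt_forms assms, of a]
      eq [OF assms] eq [OF graded_derivationD(2) [OF d assms]] by simp
qed

lemma anchor_of_mult: "anchor_of d x (a * b) = anchor_of d x a * b + a * anchor_of d x b"
proof -
  have "smul a (const_form b) = (const_form (a * b) :: 'l list \<Rightarrow> 'a)"
    by (simp add: fun_eq_iff smul_apply const_form_def)
  then have "d (const_form (a * b)) =
      smul ((- 1) ^ 0) (shuf (d (const_form a)) (const_form b)) + smul a (d (const_form b))"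
    using derivation_const_form_mult [OF const_form_alt_forms, of a b] by (simp only:)
  then have "d (const_form (a * b)) [x] =
      shuf (d (const_form a)) (const_form b) [x] + a * d (const_form b) [x]"
    by (simp add: smul_apply)
  then show ?thesis by (simp add: anchor_of_def ins_apply algebra_simps)
qed

lemma alternating_derivation: "f \<in> alt_forms scale m \<Longrightarrow> alternating (d f)"
  using graded_derivationD(2) [OF d, of f m] by (simp add: alt_forms_iff)

lemma anchor_of_add_left: "anchor_of d (x + y) a = anchor_of d x a + anchor_of d y a"
  using fun_cong [OF alternating_head(1) [OF alternating_derivation [OF const_form_alt_forms]],
      of x y a "[]"]
  by (simp add: anchor_of_def ins_apply)

lemma anchor_of_scale_left: "anchor_of d (scale b x) a = b * anchor_of d x a"
  using fun_cong [OF alternating_head(2) [OF alternating_derivation [OF const_form_alt_forms]],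
      of b x a "[]"]
  by (simp add: anchor_of_def ins_apply smul_apply)

lemma anchor_of_sum:
  "finite S \<Longrightarrow> anchor_of d x (\<Sum>t\<in>S. c t) = (\<Sum>t\<in>S. anchor_of d x (c t))"
proof (induction S rule: finite_induct)
  case empty
  show ?case using anchor_of_add [of x 0 0] by simp
qed (simp add: anchor_of_add)

text \<open>Apply \<open>d\<close> to the expansion of \<open>\<psi>\<close> in the coordinate forms
  \<open>\<phi> t\<close>, with coefficients \<open>\<psi> (e t)\<close>; differentiating the
  coefficients gives the anchor terms.\<close>

lemma derivation_one_form:
  assumes \<psi>: "linear_map scale (*) \<psi>"
  shows "d (one_form \<psi>) [x, y] = (\<Sum>t\<in>T. anchor_of d x (\<psi> (e t)) * \<phi> t y
    - anchor_of d y (\<psi> (e t)) * \<phi> t x + \<psi> (e t) * d (one_form (\<phi> t)) [x, y])"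
proof -
  let ?tm = "\<lambda>t. smul (\<psi> (e t)) (one_form (\<phi> t))"
  have tm: "?tm t \<in> alt_forms scale (Suc 0)" for t
    by (intro smul_alt_forms one_form_alt_forms linear_coord)
  have d_tm: "d (?tm t) [x, y] = anchor_of d x (\<psi> (e t)) * \<phi> t y
      - anchor_of d y (\<psi> (e t)) * \<phi> t x + \<psi> (e t) * d (one_form (\<phi> t)) [x, y]" for t
  proof -
    have "d (?tm t) [x, y] = (smul ((- 1) ^ Suc 0) (shuf (d (const_form (\<psi> (e t)))) (one_form (\<phi> t)))
        + smul (\<psi> (e t)) (d (one_form (\<phi> t)))) [x, y]"
      by (rule fun_cong [OF derivation_const_form_mult [OF one_form_alt_forms [OF linear_coord]]])
    also have "\<dots> = - (d (const_form (\<psi> (e t))) [x] * \<phi> t y - d (const_form (\<psi> (e t))) [y] * \<phi> t x)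
        + \<psi> (e t) * d (one_form (\<phi> t)) [x, y]"
      by (simp only: plus_fun_apply smul_apply shuf_one_form_apply minus_one_power_mult even_Suc
          even_zero not_True_eq_False if_False)
    finally show ?thesis
      by (simp only: anchor_of_def minus_diff_eq mult_minus_left diff_minus_eq_add add.commute
          minus_add_distrib diff_conv_add_uminus minus_minus)
  qed
  have "(\<Sum>t\<in>S. ?tm t) \<in> alt_forms scale (Suc 0) \<and>
      d (\<Sum>t\<in>S. ?tm t) [x, y] = (\<Sum>t\<in>S. d (?tm t) [x, y])" if "finite S" for S
    using that
  proof (induction S)
    case empty
    have "d 0 [x, y] = 0"
      by (simp add: graded_derivation_zero [OF d])
    with zero_alt_forms [of "Suc 0"] show ?case
      by (simp only: sum.empty simp_thms)
  next
    case (insert t S)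
    let ?s = "\<Sum>t\<in>S. ?tm t"
    have s: "?s \<in> alt_forms scale (Suc 0)" using insert by blast
    have "d (?tm t + ?s) [x, y] = d (?tm t) [x, y] + d ?s [x, y]"
      by (simp only: graded_derivationD(1) [OF d] alt_forms_subset_Alt [OF tm]
          alt_forms_subset_Alt [OF s] plus_fun_apply)
    moreover have "(\<Sum>t\<in>insert t S. ?tm t) = ?tm t + ?s"
      using insert by (intro sum.insert)
    ultimately show ?case
      using insert add_alt_forms [OF tm s] by (simp only: sum.insert simp_thms)
  qed
  moreover have "one_form \<psi> = (\<Sum>t\<in>T. ?tm t)"
  proof
    fix xs
    have sum_apply: "(\<Sum>t\<in>S. ?tm t) ys = (\<Sum>t\<in>S. ?tm t ys)" if "finite S" for S ys
      using that by (induction S) simp_all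
    show "one_form \<psi> xs = (\<Sum>t\<in>T. ?tm t) xs"
    proof (cases "\<exists>z. xs = [z]")
      case True
      then obtain z where "xs = [z]" ..
      then show ?thesis
        using linear_form_expand [OF \<psi>, of z]
        by (simp only: sum_apply [OF finite_basis] one_form_simps smul_apply mult.commute)
    next
      case False
      then show ?thesis
        by (auto simp: sum_apply [OF finite_basis] one_form_def smul_apply split: list.split)
    qed
  qed
  ultimately show ?thesis using finite_basis by (simp add: d_tm)
qed

text \<open>The right-hand side is linear in \<open>\<psi>\<close> over \<open>A\<close>: the
  derivatives of the coefficients \<open>\<psi> (e t)\<close> arising from the anchors cancel those
  in \<open>derivation_one_form\<close>. Hence the case of the coordinate forms suffices.\<close>

lemma bracket_of_form:
  assumes \<psi>: "linear_map scale (*) \<psi>"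
  shows "\<psi> (bracket_of d x y) =
    anchor_of d x (\<psi> y) - anchor_of d y (\<psi> x) - d (one_form \<psi>) [x, y]"
proof -
  have expand: "anchor_of d x (\<psi> y) =
      (\<Sum>t\<in>T. anchor_of d x (\<phi> t y) * \<psi> (e t) + \<phi> t y * anchor_of d x (\<psi> (e t)))" for x y
    using arg_cong [OF linear_form_expand [OF \<psi>, of y], of "anchor_of d x"]
    by (simp only: anchor_of_sum [OF finite_basis] anchor_of_mult)
  show ?thesis
    unfolding bracket_of_def linear_map_sum_scale_form [OF \<psi> finite_basis]
      derivation_one_form [OF \<psi>] expand [of x y] expand [of y x]
      sum_subtractf [symmetric]
    by (intro sum.cong refl) (simp add: algebra_simps)
qed

text \<open>Each bracket identity is tested under linear forms through
  \<open>bracket_of_form\<close>, where it reduces to the alternating bilinearity of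
  \<open>d (one_form \<psi>)\<close> and the product rule of the anchor.\<close>

lemma pre_lie_rinehart_of: "pre_lie_rinehart scale (bracket_of d) (anchor_of d)"
proof unfold_locales
  fix x y z :: 'l and a b :: 'a
  show "anchor_of d x (a + b) = anchor_of d x a + anchor_of d x b"
    by (rule anchor_of_add)
  show "anchor_of d x (a * b) = anchor_of d x a * b + a * anchor_of d x b"
    by (rule anchor_of_mult)
  show "anchor_of d (x + y) a = anchor_of d x a + anchor_of d y a"
    by (rule anchor_of_add_left)
  show "anchor_of d (scale b x) a = b * anchor_of d x a"
    by (rule anchor_of_scale_left)
  have two: "d (one_form \<psi>) [x + y, z] = d (one_form \<psi>) [x, z] + d (one_form \<psi>) [y, z]"
    "d (one_form \<psi>) [x, y + z] = d (one_form \<psi>) [x, y] + d (one_form \<psi>) [x, z]"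
    "d (one_form \<psi>) [x, scale a y] = a * d (one_form \<psi>) [x, y]"
    "d (one_form \<psi>) [x, x] = 0"
    if "linear_map scale (*) \<psi>" for \<psi>
  proof -
    have "alternating (d (one_form \<psi>))"
      by (rule alternating_derivation [OF one_form_alt_forms [OF that]])
    then have "d (one_form \<psi>) ([] @ (x + y) # [z]) =
        d (one_form \<psi>) ([] @ x # [z]) + d (one_form \<psi>) ([] @ y # [z])"
      "d (one_form \<psi>) ([x] @ (y + z) # []) =
        d (one_form \<psi>) ([x] @ y # []) + d (one_form \<psi>) ([x] @ z # [])"
      "d (one_form \<psi>) ([x] @ scale a y # []) = a * d (one_form \<psi>) ([x] @ y # [])"
      "d (one_form \<psi>) ([] @ x # x # []) = 0"
      unfolding alternating_def by blast+
    then show "d (one_form \<psi>) [x + y, z] = d (one_form \<psi>) [x, z] + d (one_form \<psi>) [y, z]"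
      "d (one_form \<psi>) [x, y + z] = d (one_form \<psi>) [x, y] + d (one_form \<psi>) [x, z]"
      "d (one_form \<psi>) [x, scale a y] = a * d (one_form \<psi>) [x, y]"
      "d (one_form \<psi>) [x, x] = 0"
      by simp_all
  qed
  have lin: "\<psi> (x + y) = \<psi> x + \<psi> y" "\<psi> (scale a x) = a * \<psi> x"
    if "linear_map scale (*) \<psi>" for \<psi> x y a
    using that by (auto simp: linear_map_def)
  show "bracket_of d (x + y) z = bracket_of d x z + bracket_of d y z"
  proof (rule eq_if_linear_maps_eq)
    fix \<psi> assume \<psi>: "linear_map scale (*) \<psi>"
    show "\<psi> (bracket_of d (x + y) z) = \<psi> (bracket_of d x z + bracket_of d y z)"
      by (simp add: bracket_of_form [OF \<psi>] lin [OF \<psi>] two [OF \<psi>] anchor_of_add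
          anchor_of_add_left algebra_simps)
  qed
  show "bracket_of d x (y + z) = bracket_of d x y + bracket_of d x z"
  proof (rule eq_if_linear_maps_eq)
    fix \<psi> assume \<psi>: "linear_map scale (*) \<psi>"
    show "\<psi> (bracket_of d x (y + z)) = \<psi> (bracket_of d x y + bracket_of d x z)"
      by (simp add: bracket_of_form [OF \<psi>] lin [OF \<psi>] two [OF \<psi>] anchor_of_add
          anchor_of_add_left algebra_simps)
  qed
  show "bracket_of d x x = 0"
  proof (rule eq_if_linear_maps_eq)
    fix \<psi> assume \<psi>: "linear_map scale (*) \<psi>"
    show "\<psi> (bracket_of d x x) = \<psi> 0"
      using lin(1) [OF \<psi>, of 0 0] by (simp add: bracket_of_form [OF \<psi>] two [OF \<psi>])
  qed
  show "bracket_of d x (scale a y) = scale (anchor_of d x a) y + scale a (bracket_of d x y)"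
  proof (rule eq_if_linear_maps_eq)
    fix \<psi> assume \<psi>: "linear_map scale (*) \<psi>"
    show "\<psi> (bracket_of d x (scale a y)) = \<psi> (scale (anchor_of d x a) y + scale a (bracket_of d x y))"
      by (simp add: bracket_of_form [OF \<psi>] lin [OF \<psi>] two [OF \<psi>] anchor_of_mult
          anchor_of_scale_left algebra_simps)
  qed
qed

text \<open>Both operators are graded derivations, and bracket and anchor were chosen so that they
  agree on forms of 0 variables and on the coordinate 1-forms, which generate.\<close>

lemma derivation_eq_cce:
  assumes "f \<in> Alt scale"
  shows "d f = cce scale (bracket_of d) (anchor_of d) f"
proof -
  interpret pre_lie_rinehart scale "bracket_of d" "anchor_of d"
    by (rule pre_lie_rinehart_of)
  have comp: "component (Suc m) (d f) = d f"
    "component (Suc m) (cce scale (bracket_of d) (anchor_of d) f) =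
       cce scale (bracket_of d) (anchor_of d) f" if "f \<in> alt_forms scale m" for f m
    using graded_derivationD(2) [OF d that] graded_derivationD(2) [OF graded_derivation_cce that]
    by (simp_all add: alt_forms_iff)
  have "d (const_form a) = cce scale (bracket_of d) (anchor_of d) (const_form a)" for a
  proof (rule component_eqI [OF comp [OF const_form_alt_forms]])
    fix xs :: "'l list" assume "length xs = Suc 0"
    then obtain x where "xs = [x]" by (auto simp: length_Suc_conv)
    then show "d (const_form a) xs = cce scale (bracket_of d) (anchor_of d) (const_form a) xs"
      using cce_eq [OF alt_forms_subset_Alt [OF const_form_alt_forms]]
        cder_const_form_apply [of a x]
      by (simp add: grade_sign_apply anchor_of_def)
  qed
  moreover have "d (one_form (\<phi> t)) = cce scale (bracket_of d) (anchor_of d) (one_form (\<phi> t))" for t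
  proof (rule component_eqI [OF comp [OF one_form_alt_forms [OF linear_coord]]])
    fix xs :: "'l list" assume "length xs = Suc (Suc 0)"
    then obtain x y where "xs = [x, y]" by (auto simp: length_Suc_conv)
    then show "d (one_form (\<phi> t)) xs =
        cce scale (bracket_of d) (anchor_of d) (one_form (\<phi> t)) xs"
      using cce_eq [OF alt_forms_subset_Alt [OF one_form_alt_forms [OF linear_coord]]]
        cder_one_form_apply [of "\<phi> t" x y]
      by (simp add: grade_sign_apply bracket_of_form [OF linear_coord] del: cder.simps)
  qed
  ultimately show ?thesis
    by (rule graded_derivation_eqI [OF d graded_derivation_cce _ _ assms])
qed

text \<open>Evaluate \<open>dd = 0\<close> on a constant at \<open>[x, y]\<close> to obtain the
  morphism property of the anchor, then on a 1-form at \<open>[x, y, z]\<close> to obtain the Jacobi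
  identity.\<close>

lemma lie_rinehart_of:
  assumes "\<And>f. f \<in> Alt scale \<Longrightarrow> d (d f) = 0"
  shows "pre_lie_rinehart.lie_rinehart (bracket_of d) (anchor_of d)"
proof -
  interpret pre_lie_rinehart scale "bracket_of d" "anchor_of d"
    by (rule pre_lie_rinehart_of)
  have cder_cder: "cder (cder f) xs = 0" if "f \<in> Alt scale" for f xs
  proof -
    \<comment> \<open>\<open>grade_sign\<close> anticommutes with \<open>cder\<close> and is an
      involution, so passing to the unsigned operator costs only a global minus sign.\<close>
    have "grade_sign (cder (grade_sign (cder f))) = 0"
      using assms [OF that] derivation_eq_cce [OF that] cce_eq [OF that]
        derivation_eq_cce [OF grade_sign_cder_Alt [OF that]] cce_eq [OF grade_sign_cder_Alt [OF that]]
      by simp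
    then have "- cder (cder f) = 0"
      by (simp only: cder_simps grade_sign_simps)
    then have "(- cder (cder f)) xs = 0 xs" by (rule fun_cong)
    then show ?thesis by simp
  qed
  have anchor: "anchor_of d (bracket_of d x y) a =
      anchor_of d x (anchor_of d y a) - anchor_of d y (anchor_of d x a)" for x y a
    using cder_cder [OF alt_forms_subset_Alt [OF const_form_alt_forms], of a "[x, y]"]
    by (simp add: ins_apply algebra_simps)
  have "bracket_of d x (bracket_of d y z) + bracket_of d y (bracket_of d z x)
      + bracket_of d z (bracket_of d x y) = 0" for x y z
  proof (rule eq_if_linear_maps_eq)
    fix \<psi> assume \<psi>: "linear_map scale (*) \<psi>"
    have lin: "\<psi> (x + y) = \<psi> x + \<psi> y" for x y
      using \<psi> by (simp add: linear_map_def)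
    have zero: "\<psi> 0 = 0"
      using lin [of 0 0] by simp
    have minus: "\<psi> (- x) = - \<psi> x" for x
      using lin [of x "- x"] by (simp add: zero eq_neg_iff_add_eq_0 add.commute)
    have diff: "\<psi> (x - y) = \<psi> x - \<psi> y" for x y
      using lin [of x "- y"] by (simp add: minus)
    \<comment> \<open>With the morphism property of the anchor all derivative terms cancel here,
      leaving \<open>\<psi>\<close> of the Jacobi sum up to sign.\<close>
    have *: "cder (cder (one_form \<psi>)) [x, y, z] = 0"
      using \<psi> by (intro cder_cder alt_forms_subset_Alt [OF one_form_alt_forms])
    have "bracket_of d y (bracket_of d z x) = - bracket_of d y (bracket_of d x z)"
      by (simp only: br_swap [of z x] br_minus_right)
    moreover have "bracket_of d z (bracket_of d x y) = - bracket_of d (bracket_of d x y) z"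
      by (rule br_swap)
    ultimately show "\<psi> (bracket_of d x (bracket_of d y z) + bracket_of d y (bracket_of d z x)
        + bracket_of d z (bracket_of d x y)) = \<psi> 0"
      using *
      by (simp add: lin minus diff zero ins_apply anchor anchor_diff algebra_simps)
  qed
  with anchor show ?thesis by (simp add: lie_rinehart_def)
qed

end

end

theorem theorem2p2p16:
  fixes \<eta> :: "'r::{comm_ring, comm_monoid_mult} \<Rightarrow> 'a::{comm_ring, comm_monoid_mult}"
    and scale :: "'a \<Rightarrow> 'l::ab_group_add \<Rightarrow> 'l"
  assumes "comm_algebra \<eta>"
    and "unital_module scale"
    and "finitely_generated scale"
    and "projective scale"
  shows "bij_betw (\<lambda>(br, anchor). cce scale br anchor)
           (lie_rinehart_structures \<eta> scale) (maurer_cartan_structures \<eta> scale)"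
proof -
  obtain T :: "'l set" and \<phi> e where "dual_basis scale T \<phi> e"
    using finite_projective_dual_basis [OF assms(2-4)] .
  then interpret dual_basis scale T \<phi> e .
  note pre = lie_rinehart_structures_pre_lie_rinehart [OF assms(2)]
  show ?thesis
  proof (rule bij_betw_imageI)
    show "inj_on (\<lambda>(br, anchor). cce scale br anchor) (lie_rinehart_structures \<eta> scale)"
    proof (rule inj_onI, clarify)
      fix br anchor br' anchor'
      assume "(br, anchor) \<in> lie_rinehart_structures \<eta> scale"
        "(br', anchor') \<in> lie_rinehart_structures \<eta> scale"
        "cce scale br anchor = cce scale br' anchor'"
      then show "br = br' \<and> anchor = anchor'"
        using cce_inj [OF pre(1) pre(1)] by blast
    qed
    show "(\<lambda>(br, anchor). cce scale br anchor) ` lie_rinehart_structures \<eta> scale =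
        maurer_cartan_structures \<eta> scale"
    proof (intro equalityI subsetI)
      fix d assume "d \<in> (\<lambda>(br, anchor). cce scale br anchor) ` lie_rinehart_structures \<eta> scale"
      then obtain br anchor where lr: "(br, anchor) \<in> lie_rinehart_structures \<eta> scale"
        and d: "d = cce scale br anchor" by auto
      show "d \<in> maurer_cartan_structures \<eta> scale"
        unfolding d by (rule pre_lie_rinehart.cce_maurer_cartan)
          (rule pre [OF lr] comm_algebra.unit_one [OF assms(1)])+
    next
      fix d assume "d \<in> maurer_cartan_structures \<eta> scale"
      then have ext: "d \<in> Alt scale \<rightarrow>\<^sub>E Alt scale" and d: "graded_derivation d"
        and lin: "\<And>r f. f \<in> Alt scale \<Longrightarrow> d (smul (\<eta> r) f) = smul (\<eta> r) (d f)"
        and dd: "\<And>f. f \<in> Alt scale \<Longrightarrow> d (d f) = 0"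
        by (simp_all add: maurer_cartan_iff)
      have lin': "anchor_of d x (\<eta> r * a) = \<eta> r * anchor_of d x a" for x r a
      proof -
        have "const_form (\<eta> r * a) = smul (\<eta> r) (const_form a :: 'l list \<Rightarrow> 'a)"
          by (simp add: fun_eq_iff smul_apply const_form_def)
        then show ?thesis
          using lin [OF alt_forms_subset_Alt [OF const_form_alt_forms], of r a]
          by (simp add: anchor_of_def smul_apply)
      qed
      have "pre_lie_rinehart.lie_rinehart (bracket_of d) (anchor_of d)"
        using d dd by (rule lie_rinehart_of)
      then have "(bracket_of d, anchor_of d) \<in> lie_rinehart_structures \<eta> scale"
        using lin' by (rule lie_rinehart_structuresI [OF pre_lie_rinehart_of [OF d]])
      moreover have "d = cce scale (bracket_of d) (anchor_of d)"
      proof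
        fix f show "d f = cce scale (bracket_of d) (anchor_of d) f"
        proof (cases "f \<in> Alt scale")
          case True
          then show ?thesis by (rule derivation_eq_cce [OF d])
        next
          case False
          \<comment> \<open>Off \<open>Alt\<close> both operators take the value
            \<open>undefined\<close>, so agreement on \<open>Alt\<close> gives equality of
            functions.\<close>
          then show ?thesis
            using PiE_arb [OF ext False] by (simp add: cce_def)
        qed
      qed
      ultimately show "d \<in> (\<lambda>(br, anchor). cce scale br anchor) ` lie_rinehart_structures \<eta> scale"
        by (auto intro: rev_image_eqI)
    qed
  qed
qed

end
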